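(* Let $\{Y_t\}_{t\ge 0}$ and $\{Z_t\}_{t\ge 0}$ be two independent Lévy processes on $\mathbb{R}$, let $0<q<p$, and let $\{X_t\}_{t\ge 0}$ be the semi-Lévy process with period $p$ defined by $X_0=0$ a.s. and, for $n=0,1,2,\dots$, $$X_t=\begin{cases}X_{np}+Y_t-Y_{np} & (np<t\le np+q),\\ X_{np+q}+Z_t-Z_{np+q} & (np+q<t\le (n+1)p).\end{cases}$$ Assume $E[|Y_1|]<\infty$ and $E[|Z_1|]<\infty$. Then $\{X_t\}_{t\ge 0}$ is recurrent if and only if $E[Y_q+Z_{p-q}]=0$.
   Context: An additive process on $\mathbb{R}$ is a real-valued stochastic process $\{X_t\}_{t\ge 0}$ with $X_0=0$ a.s. that is stochastically continuous, has independent increments, and has sample paths that are right-continuous in $t\ge 0$ with left limits in $t>0$. A Lévy process is an additive process with stationary increments. A semi-Lévy process with period $p>0$ is an additive process such that $X_{t+p}-X_{s+p}$ and $X_t-X_s$ have the same distribution for all $s,t\ge 0$. An additive process $\{X_t\}_{t\ge0}$ is recurrent if $\liminf_{t\to\infty}|X_t-X_s|=0$ a.s. for every $s\ge 0$. *)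

theory Defs
  imports "HOL-Probability.Probability"
begin

text \<open>
  A real-valued process with time set \<open>[0,\<infinity>)\<close> is a function \<open>X :: real \<Rightarrow> 'a \<Rightarrow> real\<close>, of which
  only the values at times \<open>t \<ge> 0\<close> are relevant.
\<close>

context prob_space
begin

definition stochastically_continuous :: "(real \<Rightarrow> 'a \<Rightarrow> real) \<Rightarrow> bool" where
  "stochastically_continuous X \<longleftrightarrow>
     (\<forall>t\<ge>0. \<forall>\<epsilon>>0. ((\<lambda>s. prob {\<omega> \<in> space M. \<bar>X s \<omega> - X t \<omega>\<bar> > \<epsilon>}) \<longlongrightarrow> 0) (at t within {0..}))"

definition independent_increments :: "(real \<Rightarrow> 'a \<Rightarrow> real) \<Rightarrow> bool" where
  "independent_increments X \<longleftrightarrow>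
     (\<forall>(n::nat) (t::nat \<Rightarrow> real). 0 \<le> t 0 \<and> (\<forall>i<n. t i < t (Suc i)) \<longrightarrow>
        indep_vars (\<lambda>_. borel) (\<lambda>i \<omega>. X (t (Suc i)) \<omega> - X (t i) \<omega>) {..<n})"

text \<open>
  The path property is required outside a null set, which also covers processes all of whose
  paths have it.
\<close>

definition cadlag_paths :: "(real \<Rightarrow> 'a \<Rightarrow> real) \<Rightarrow> bool" where
  "cadlag_paths X \<longleftrightarrow>
     (AE \<omega> in M. (\<forall>t\<ge>0. continuous (at_right t) (\<lambda>s. X s \<omega>)) \<and>
                 (\<forall>t>0. \<exists>l. ((\<lambda>s. X s \<omega>) \<longlongrightarrow> l) (at_left t)))"

definition additive_process :: "(real \<Rightarrow> 'a \<Rightarrow> real) \<Rightarrow> bool" where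
  "additive_process X \<longleftrightarrow>
     (\<forall>t\<ge>0. random_variable borel (X t)) \<and>
     (AE \<omega> in M. X 0 \<omega> = 0) \<and>
     stochastically_continuous X \<and>
     independent_increments X \<and>
     cadlag_paths X"

definition levy_process :: "(real \<Rightarrow> 'a \<Rightarrow> real) \<Rightarrow> bool" where
  "levy_process X \<longleftrightarrow>
     additive_process X \<and>
     (\<forall>s\<ge>0. \<forall>h\<ge>0. distr M borel (\<lambda>\<omega>. X (s + h) \<omega> - X s \<omega>) = distr M borel (\<lambda>\<omega>. X h \<omega> - X 0 \<omega>))"

definition semi_levy_process :: "real \<Rightarrow> (real \<Rightarrow> 'a \<Rightarrow> real) \<Rightarrow> bool" where
  "semi_levy_process p X \<longleftrightarrow>
     p > 0 \<and> additive_process X \<and>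
     (\<forall>s\<ge>0. \<forall>t\<ge>0. distr M borel (\<lambda>\<omega>. X (t + p) \<omega> - X (s + p) \<omega>) =
                     distr M borel (\<lambda>\<omega>. X t \<omega> - X s \<omega>))"

text \<open>
  Independence of two processes is independence of the random functions
  \<open>(X\<^sub>t)\<^sub>t\<^sub>\<ge>\<^sub>0\<close> and \<open>(Y\<^sub>t)\<^sub>t\<^sub>\<ge>\<^sub>0\<close> in the product space.
\<close>

definition independent_processes ::
    "(real \<Rightarrow> 'a \<Rightarrow> real) \<Rightarrow> (real \<Rightarrow> 'a \<Rightarrow> real) \<Rightarrow> bool" where
  "independent_processes X Y \<longleftrightarrow>
     indep_var (\<Pi>\<^sub>M t\<in>{0..}. borel) (\<lambda>\<omega>. \<lambda>t\<in>{0..}. X t \<omega>)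
               (\<Pi>\<^sub>M t\<in>{0..}. borel) (\<lambda>\<omega>. \<lambda>t\<in>{0..}. Y t \<omega>)"

definition recurrent :: "(real \<Rightarrow> 'a \<Rightarrow> real) \<Rightarrow> bool" where
  "recurrent X \<longleftrightarrow>
     (\<forall>s\<ge>0. AE \<omega> in M. Liminf at_top (\<lambda>t. ereal \<bar>X t \<omega> - X s \<omega>\<bar>) = 0)"

end

end

theory Submission
  imports Defs
begin

text \<open>
  Observed at the times \<open>s + n p\<close>, a semi-Levy process is a random walk: the increments over
  successive periods are independent and identically distributed, with mean \<open>E[X\<^sub>p]\<close>.  Here
  \<open>X\<^sub>p - X\<^sub>0 = (Y\<^sub>q - Y\<^sub>0) + (Z\<^sub>p - Z\<^sub>q)\<close>, so the mean is \<open>E[Y\<^sub>q + Z\<^bsub>p-q\<^esub>]\<close> by stationarity of the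
  increments of \<open>Z\<close>.  The theorem is therefore the statement that a semi-Levy process with integrable
  \<open>X\<^sub>p\<close> is recurrent if and only if \<open>E[X\<^sub>p] = 0\<close>.  That \<open>Y\<^sub>q\<close> and \<open>Z\<^bsub>p-q\<^esub>\<close> inherit integrability from
  \<open>Y\<^sub>1\<close> and \<open>Z\<^sub>1\<close> is a consequence of Fubini's theorem: if a sum of two independent variables is
  integrable, so is each of them (\<open>indep_sum_integrable_imp_integrable\<close>).

  If \<open>E[X\<^sub>p] = 0\<close>, the walk satisfies \<open>E|S\<^sub>n| = o(n)\<close> by truncation and orthogonality
  (\<open>iid_mean_zero_expectation_abs_sum\<close>), and a stationary walk with this property comes back near its
  starting point (\<open>stationary_walk_returns\<close>).  The reason is a counting argument.  If
  the walk had probability \<open>c > 0\<close> of never coming back to within \<open>\<epsilon>\<close>, then on average \<open>c N\<close> of its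
  positions before time \<open>N\<close> would be at distance at least \<open>\<epsilon>\<close> from every later one, hence
  \<open>\<epsilon>\<close>-separated.  But most of these positions lie in an interval of length \<open>o(N)\<close>, which has no room
  for that many separated points.

  If \<open>E[X\<^sub>p] \<noteq> 0\<close>, Garsia's maximal ergodic lemma shows that with positive probability \<open>|S\<^sub>n| \<ge> \<delta> n\<close>
  for all \<open>n\<close> (\<open>stationary_walk_linear_growth\<close>).  It remains to rule out returns inside the periods.
  Ottaviani's inequality on finer and finer grids, with right-continuity of the paths, bounds the tail
  of the oscillation over one period by twice the tail of \<open>|X\<^sub>p - X\<^sub>0|\<close>, and integrability with the
  Borel-Cantelli lemma makes the oscillation over the \<open>n\<close>-th period almost surely \<open>o(n)\<close>
  (\<open>semi_levy_process_period_oscillation\<close>).  Hence \<open>|X\<^sub>t - X\<^sub>0|\<close> tends to infinity with positive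
  probability.
\<close>

section \<open>Stationary sequences\<close>

context prob_space begin

text \<open>
  The expected number of the events \<open>D i\<close> that occur is the sum of their probabilities; a pointwise
  bound on that number thus bounds the sum.
\<close>

lemma sum_prob_le_expectation_count:
  assumes "finite I" and [measurable]: "\<And>i. i \<in> I \<Longrightarrow> D i \<in> events"
    and g: "integrable M g"
    and le: "\<And>\<omega>. \<omega> \<in> space M \<Longrightarrow> real (card {i\<in>I. \<omega> \<in> D i}) \<le> g \<omega>"
  shows "(\<Sum>i\<in>I. prob (D i)) \<le> expectation g"
proof -
  have "(\<Sum>i\<in>I. prob (D i)) = (\<Sum>i\<in>I. expectation (indicator (D i)))"
    by (intro sum.cong) (auto simp: assms)
  also have "\<dots> = expectation (\<lambda>\<omega>. \<Sum>i\<in>I. indicator (D i) \<omega>)"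
    by (subst Bochner_Integration.integral_sum)
       (auto intro!: integrable_real_indicator simp: assms emeasure_eq_measure)
  also have "\<dots> \<le> expectation g"
  proof (intro integral_mono g)
    show "integrable M (\<lambda>\<omega>. \<Sum>i\<in>I. indicator (D i) \<omega> :: real)"
      by (intro Bochner_Integration.integrable_sum integrable_real_indicator)
         (auto simp: assms emeasure_eq_measure)
    fix \<omega> assume w: "\<omega> \<in> space M"
    have "(\<Sum>i\<in>I. indicator (D i) \<omega> :: real) = real (card {i\<in>I. \<omega> \<in> D i})"
      using \<open>finite I\<close> by (simp add: indicator_def sum.If_cases Int_def)
    with le[OF w] show "(\<Sum>i\<in>I. indicator (D i) \<omega>) \<le> g \<omega>" by simp
  qed
  finally show ?thesis .
qed

definition stationary_sequence :: "(nat \<Rightarrow> 'a \<Rightarrow> real) \<Rightarrow> bool" where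
  "stationary_sequence W \<longleftrightarrow> (\<forall>i. random_variable borel (W i)) \<and>
     (\<forall>m. distr M (PiM UNIV (\<lambda>_. borel)) (\<lambda>\<omega> i. W (m + i) \<omega>) =
          distr M (PiM UNIV (\<lambda>_. borel)) (\<lambda>\<omega> i. W i \<omega>))"

lemma stationary_sequence_measurable:
  "stationary_sequence W \<Longrightarrow> random_variable borel (W i)"
  by (simp add: stationary_sequence_def)

lemma stationary_sequence_prob_shift:
  assumes W: "stationary_sequence W" and [measurable]: "Measurable.pred (PiM UNIV (\<lambda>_. borel)) P"
  shows "prob {\<omega>\<in>space M. P (\<lambda>i. W (m + i) \<omega>)} = prob {\<omega>\<in>space M. P (\<lambda>i. W i \<omega>)}"
proof -
  note [measurable] = stationary_sequence_measurable[OF W]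
  have eq: "prob {\<omega>\<in>space M. P (\<lambda>i. W (m + i) \<omega>)} =
      measure (distr M (PiM UNIV (\<lambda>_. borel)) (\<lambda>\<omega> i. W (m + i) \<omega>)) {x. P x}" for m
  proof (subst measure_distr)
    show "(\<lambda>\<omega> i. W (m + i) \<omega>) \<in> M \<rightarrow>\<^sub>M PiM UNIV (\<lambda>_. borel)"
      by (rule measurable_PiM_single') auto
    have "{x \<in> space (PiM UNIV (\<lambda>_. borel)). P x} \<in> sets (PiM UNIV (\<lambda>_. borel))" by measurable
    then show "{x. P x} \<in> sets (PiM UNIV (\<lambda>_. borel))" by (simp add: space_PiM)
    show "prob {\<omega>\<in>space M. P (\<lambda>i. W (m + i) \<omega>)} =
        prob ((\<lambda>\<omega> i. W (m + i) \<omega>) -` {x. P x} \<inter> space M)"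
      by (intro arg_cong[where f=prob]) auto
  qed
  show ?thesis
    using eq[of m] eq[of 0] W by (simp add: stationary_sequence_def)
qed

lemma stationary_sequence_expectation_shift:
  fixes f :: "(nat \<Rightarrow> real) \<Rightarrow> real"
  assumes W: "stationary_sequence W" and [measurable]: "f \<in> borel_measurable (PiM UNIV (\<lambda>_. borel))"
  shows "integrable M (\<lambda>\<omega>. f (\<lambda>i. W (m + i) \<omega>)) \<longleftrightarrow> integrable M (\<lambda>\<omega>. f (\<lambda>i. W i \<omega>))"
    and "expectation (\<lambda>\<omega>. f (\<lambda>i. W (m + i) \<omega>)) = expectation (\<lambda>\<omega>. f (\<lambda>i. W i \<omega>))"
proof -
  note [measurable] = stationary_sequence_measurable[OF W]
  have [measurable]: "(\<lambda>\<omega> i. W (m + i) \<omega>) \<in> M \<rightarrow>\<^sub>M PiM UNIV (\<lambda>_. borel)" for m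
    by (rule measurable_PiM_single') auto
  have [measurable]: "(\<lambda>\<omega> i. W i \<omega>) \<in> M \<rightarrow>\<^sub>M PiM UNIV (\<lambda>_. borel)"
    by (rule measurable_PiM_single') auto
  have eq: "distr M (PiM UNIV (\<lambda>_. borel)) (\<lambda>\<omega> i. W (m + i) \<omega>) =
          distr M (PiM UNIV (\<lambda>_. borel)) (\<lambda>\<omega> i. W i \<omega>)"
    using W by (simp add: stationary_sequence_def)
  show "integrable M (\<lambda>\<omega>. f (\<lambda>i. W (m + i) \<omega>)) \<longleftrightarrow> integrable M (\<lambda>\<omega>. f (\<lambda>i. W i \<omega>))"
    using integrable_distr_eq[of "\<lambda>\<omega> i. W (m + i) \<omega>" M "PiM UNIV (\<lambda>_. borel)" f]
      integrable_distr_eq[of "\<lambda>\<omega> i. W i \<omega>" M "PiM UNIV (\<lambda>_. borel)" f] eq by simp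
  show "expectation (\<lambda>\<omega>. f (\<lambda>i. W (m + i) \<omega>)) = expectation (\<lambda>\<omega>. f (\<lambda>i. W i \<omega>))"
    using integral_distr[of "\<lambda>\<omega> i. W (m + i) \<omega>" M "PiM UNIV (\<lambda>_. borel)" f]
      integral_distr[of "\<lambda>\<omega> i. W i \<omega>" M "PiM UNIV (\<lambda>_. borel)" f] eq by simp
qed

lemma stationary_sequence_compose:
  assumes W: "stationary_sequence W" and f [measurable]: "f \<in> borel_measurable borel"
  shows "stationary_sequence (\<lambda>i \<omega>. f (W i \<omega>))"
  unfolding stationary_sequence_def
proof (intro conjI allI)
  note [measurable] = stationary_sequence_measurable[OF W]
  show "random_variable borel (\<lambda>\<omega>. f (W i \<omega>))" for i by measurable
  have rv: "(\<lambda>\<omega> i. W (m + i) \<omega>) \<in> M \<rightarrow>\<^sub>M PiM UNIV (\<lambda>_. borel)" for m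
    by (rule measurable_PiM_single') auto
  have F: "(\<lambda>x i. f (x i)) \<in> PiM UNIV (\<lambda>_::nat. borel) \<rightarrow>\<^sub>M PiM UNIV (\<lambda>_. borel)"
    by (rule measurable_PiM_single') auto
  have law: "distr M (PiM UNIV (\<lambda>_. borel)) (\<lambda>\<omega> i. f (W (m + i) \<omega>)) =
      distr (distr M (PiM UNIV (\<lambda>_. borel)) (\<lambda>\<omega> i. W (m + i) \<omega>)) (PiM UNIV (\<lambda>_. borel)) (\<lambda>x i. f (x i))" for m
    by (subst distr_distr[OF F rv]) (simp add: comp_def)
  show "distr M (PiM UNIV (\<lambda>_. borel)) (\<lambda>\<omega> i. f (W (m + i) \<omega>)) =
      distr M (PiM UNIV (\<lambda>_. borel)) (\<lambda>\<omega> i. f (W i \<omega>))" for m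
    using law[of m] law[of 0] W by (simp add: stationary_sequence_def)
qed

lemma stationary_sequence_marginal:
  fixes f :: "real \<Rightarrow> real"
  assumes W: "stationary_sequence W" and [measurable]: "f \<in> borel_measurable borel"
  shows "integrable M (\<lambda>\<omega>. f (W i \<omega>)) \<longleftrightarrow> integrable M (\<lambda>\<omega>. f (W 0 \<omega>))"
    and "expectation (\<lambda>\<omega>. f (W i \<omega>)) = expectation (\<lambda>\<omega>. f (W 0 \<omega>))"
  using stationary_sequence_expectation_shift[OF W, of "\<lambda>x. f (x 0)" i] by simp_all

text \<open>
  For finitely many indices the product rule of the shifted family is the product rule of the original
  family on the translated index set.
\<close>

lemma indep_vars_shift:
  assumes "indep_vars (\<lambda>_. N) W (UNIV :: nat set)"
  shows "indep_vars (\<lambda>_. N) (\<lambda>i. W (m + i)) UNIV"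
  unfolding indep_vars_def2
proof (intro conjI ballI)
  show "random_variable N (W (m + i))" for i
    using assms by (auto simp: indep_vars_def2)
  let ?F = "\<lambda>i. {W i -` A \<inter> space M |A. A \<in> sets N}"
  have ind: "indep_sets ?F UNIV" using assms by (simp add: indep_vars_def2)
  show "indep_sets (\<lambda>i. {W (m + i) -` A \<inter> space M |A. A \<in> sets N}) UNIV"
  proof (rule indep_setsI)
    show "{W (m + i) -` A \<inter> space M |A. A \<in> sets N} \<subseteq> events" for i
      using ind by (auto simp: indep_sets_def)
    fix A :: "nat \<Rightarrow> 'a set" and J :: "nat set"
    assume J: "J \<noteq> {}" "finite J" and A: "\<forall>j\<in>J. A j \<in> ?F (m + j)"
    have "prob (\<Inter>j\<in>(+) m ` J. A (j - m)) = (\<Prod>j\<in>(+) m ` J. prob (A (j - m)))"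
      by (intro indep_setsD[OF ind]) (use J A in auto)
    then show "prob (\<Inter>j\<in>J. A j) = (\<Prod>j\<in>J. prob (A j))"
      by (simp add: prod.reindex)
  qed
qed

text \<open>
  The joint law of an independent family is the product of its marginals, and all shifts have the same
  marginals.
\<close>

lemma iid_imp_stationary_sequence:
  assumes ind: "indep_vars (\<lambda>_. borel) W UNIV"
    and id: "\<And>i. distr M borel (W i) = distr M borel (W 0)"
  shows "stationary_sequence W"
  unfolding stationary_sequence_def
proof (intro conjI allI)
  have rv: "random_variable borel (W i)" for i
    using ind by (auto simp: indep_vars_def2)
  then show "random_variable borel (W i)" for i .
  have law: "distr M (PiM UNIV (\<lambda>_. borel)) (\<lambda>\<omega> i. W (m + i) \<omega>) = PiM UNIV (\<lambda>_. distr M borel (W 0))" for m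
  proof -
    have "distr M (PiM UNIV (\<lambda>_. borel)) (\<lambda>\<omega>. \<lambda>i\<in>UNIV. W (m + i) \<omega>) = PiM UNIV (\<lambda>i. distr M borel (W (m + i)))"
      by (rule iffD1[OF indep_vars_iff_distr_eq_PiM indep_vars_shift[OF ind]]) (auto intro: rv)
    then show ?thesis by (simp add: id[of "m + _"] restrict_def)
  qed
  show "distr M (PiM UNIV (\<lambda>_. borel)) (\<lambda>\<omega> i. W (m + i) \<omega>) =
          distr M (PiM UNIV (\<lambda>_. borel)) (\<lambda>\<omega> i. W i \<omega>)" for m
    using law[of m] law[of 0] by simp
qed

end

section \<open>Returns of walks with sublinear growth\<close>

lemma card_separated_le:
  fixes f :: "'b::linorder \<Rightarrow> real"
  assumes "finite F" "\<epsilon> > 0" and bd: "\<And>m. m \<in> F \<Longrightarrow> \<bar>f m\<bar> \<le> L" and "0 \<le> L"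
    and sep: "\<And>m n. m \<in> F \<Longrightarrow> n \<in> F \<Longrightarrow> m < n \<Longrightarrow> \<epsilon> \<le> \<bar>f n - f m\<bar>"
  shows "real (card F) \<le> 2 * L / \<epsilon> + 1"
proof -
  \<comment> \<open>Each cell of length \<open>\<epsilon>\<close> of the interval \<open>[-L, L]\<close> contains at most one of the points.\<close>
  define h where "h m = \<lfloor>(f m + L) / \<epsilon>\<rfloor>" for m
  have ne: "h m \<noteq> h n" if "m \<in> F" "n \<in> F" "m < n" for m n
  proof
    assume "h m = h n"
    then have "\<bar>(f n + L) / \<epsilon> - (f m + L) / \<epsilon>\<bar> < 1" unfolding h_def by linarith
    then have "\<bar>(f n - f m) / \<epsilon>\<bar> < 1" by (simp add: add_divide_distrib diff_divide_distrib)
    then show False using sep[OF that] \<open>\<epsilon> > 0\<close> by (simp add: abs_divide)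
  qed
  have "inj_on h F"
    by (rule inj_onI) (metis ne neq_iff)
  moreover have "h ` F \<subseteq> {0..\<lfloor>2 * L / \<epsilon>\<rfloor>}"
  proof
    fix y assume "y \<in> h ` F"
    then obtain m where m: "m \<in> F" "y = h m" by blast
    have "0 \<le> f m + L" "f m + L \<le> 2 * L" using bd[OF m(1)] by linarith+
    then show "y \<in> {0..\<lfloor>2 * L / \<epsilon>\<rfloor>}"
      using \<open>\<epsilon> > 0\<close> unfolding m(2) h_def by (auto intro!: floor_mono divide_right_mono)
  qed
  ultimately have "card F \<le> card {0..\<lfloor>2 * L / \<epsilon>\<rfloor>}"
    by (metis card_image card_mono finite_atLeastAtMost_int)
  also have "real \<dots> \<le> 2 * L / \<epsilon> + 1"
    using \<open>\<epsilon> > 0\<close> \<open>0 \<le> L\<close> by simp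
  finally show ?thesis by linarith
qed

lemma pred_partial_sums_ge:
  "Measurable.pred (PiM UNIV (\<lambda>_. borel)) (\<lambda>x::nat \<Rightarrow> real. \<forall>n\<ge>1. \<epsilon> \<le> \<bar>\<Sum>i<n. x i\<bar>)"
  by measurable

context prob_space begin

lemma prob_abs_greater_le_expectation:
  assumes "integrable M f" "t > 0"
  shows "prob {\<omega>\<in>space M. \<bar>f \<omega>\<bar> > t} \<le> expectation (\<lambda>\<omega>. \<bar>f \<omega>\<bar>) / t"
proof -
  note [measurable] = borel_measurable_integrable[OF assms(1)]
  have "prob {\<omega>\<in>space M. \<bar>f \<omega>\<bar> > t} \<le> prob {\<omega>\<in>space M. \<bar>f \<omega>\<bar> \<ge> t}"
    by (intro finite_measure_mono) auto
  also have "\<dots> \<le> expectation (\<lambda>\<omega>. \<bar>f \<omega>\<bar>) / t"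
    by (intro integral_Markov_inequality_measure[where A="{}"]) (use assms in auto)
  finally show ?thesis .
qed

text \<open>
  By stationarity, each time \<open>m\<close> is with the same probability \<open>c\<close> a time after which the walk stays at
  distance at least \<open>\<epsilon>\<close> from its position at \<open>m\<close>.  The positions at such times are \<open>\<epsilon>\<close>-separated, so
  at most \<open>2 \<eta> N / \<epsilon> + 1\<close> of those before \<open>N\<close> lie in \<open>[- \<eta> N, \<eta> N]\<close>.  Positions
  outside this interval are rare, by \<open>E|S\<^sub>m| = o(m)\<close> and Markov's inequality.  Comparing with the
  expected number \<open>c N\<close> of such times gives \<open>c \<le> O(\<eta>)\<close>.
\<close>

lemma no_return_prob_zero:
  assumes W: "stationary_sequence W" and int: "\<And>i. integrable M (W i)"
    and small: "\<And>\<delta>. \<delta> > 0 \<Longrightarrow> \<exists>C. \<forall>n. expectation (\<lambda>\<omega>. \<bar>\<Sum>i<n. W i \<omega>\<bar>) \<le> \<delta> * real n + C"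
    and "\<epsilon> > 0"
  shows "prob {\<omega>\<in>space M. \<forall>n\<ge>1. \<epsilon> \<le> \<bar>\<Sum>i<n. W i \<omega>\<bar>} = 0"
proof -
  note [measurable] = stationary_sequence_measurable[OF W]
  define S where "S n \<omega> = (\<Sum>i<n. W i \<omega>)" for n \<omega>
  have S_m [measurable]: "random_variable borel (S n)" for n unfolding S_def by measurable
  have S_int: "integrable M (S n)" for n
    unfolding S_def[abs_def] by (intro Bochner_Integration.integrable_sum int)
  have S_diff: "S (m + n) \<omega> - S m \<omega> = (\<Sum>i<n. W (m + i) \<omega>)" for m n \<omega>
    unfolding S_def by (induction n) auto
  define c where "c = prob {\<omega>\<in>space M. \<forall>n\<ge>1. \<epsilon> \<le> \<bar>\<Sum>i<n. W i \<omega>\<bar>}"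
  define A where "A m = {\<omega>\<in>space M. \<forall>n\<ge>1. \<epsilon> \<le> \<bar>S (m + n) \<omega> - S m \<omega>\<bar>}" for m
  have A_m [measurable]: "A m \<in> events" for m unfolding A_def by measurable
  have prob_A: "prob (A m) = c" for m
    unfolding A_def S_diff c_def by (rule stationary_sequence_prob_shift[OF W pred_partial_sums_ge])
  have c0: "0 \<le> c" unfolding c_def by simp
  have key: "c \<le> \<eta> * (2 / \<epsilon> + 1)" if \<eta>: "\<eta> > 0" for \<eta>
  proof -
    \<comment> \<open>The slope \<open>\<eta>\<^sup>2\<close> leaves a factor \<open>\<eta>\<close> after division by \<open>\<eta> N\<close> in Markov's inequality.\<close>
    obtain C where C: "\<And>n. expectation (\<lambda>\<omega>. \<bar>S n \<omega>\<bar>) \<le> \<eta>^2 * real n + C"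
      using small[of "\<eta>^2"] \<eta> unfolding S_def by auto
    have bound: "c \<le> \<eta> * (2 / \<epsilon> + 1) + (1 + C / \<eta>) / real N" if "N > 0" for N :: nat
    proof -
      define B where "B m = {\<omega>\<in>space M. \<bar>S m \<omega>\<bar> > \<eta> * real N}" for m
      have B_m [measurable]: "B m \<in> events" for m unfolding B_def by measurable
      have "real N * c = (\<Sum>m<N. prob (A m))" by (simp add: prob_A)
      also have "\<dots> \<le> (\<Sum>m<N. prob (A m - B m) + prob (B m))"
      proof (intro sum_mono)
        fix m
        have "prob (A m) \<le> prob ((A m - B m) \<union> B m)" by (intro finite_measure_mono) auto
        also have "\<dots> \<le> prob (A m - B m) + prob (B m)" by (intro measure_Un_le) auto
        finally show "prob (A m) \<le> prob (A m - B m) + prob (B m)" .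
      qed
      also have "\<dots> = (\<Sum>m<N. prob (A m - B m)) + (\<Sum>m<N. prob (B m))" by (rule sum.distrib)
      also have "(\<Sum>m<N. prob (A m - B m)) \<le> expectation (\<lambda>_. 2 * (\<eta> * real N) / \<epsilon> + 1)"
      proof (rule sum_prob_le_expectation_count)
        fix \<omega> assume "\<omega> \<in> space M"
        show "real (card {m\<in>{..<N}. \<omega> \<in> A m - B m}) \<le> 2 * (\<eta> * real N) / \<epsilon> + 1"
        proof (rule card_separated_le[where f="\<lambda>m. S m \<omega>"])
          fix m n assume "m \<in> {m\<in>{..<N}. \<omega> \<in> A m - B m}" "m < n"
          then have "\<omega> \<in> A m" "n - m \<ge> 1" by auto
          then have "\<epsilon> \<le> \<bar>S (m + (n - m)) \<omega> - S m \<omega>\<bar>" unfolding A_def by blast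
          with \<open>m < n\<close> show "\<epsilon> \<le> \<bar>S n \<omega> - S m \<omega>\<bar>" by simp
        qed (use \<eta> \<open>\<epsilon> > 0\<close> in \<open>auto simp: A_def B_def\<close>)
      qed auto
      also have "expectation (\<lambda>_. 2 * (\<eta> * real N) / \<epsilon> + 1) = 2 * (\<eta> * real N) / \<epsilon> + 1"
        by (simp add: prob_space)
      also have "(\<Sum>m<N. prob (B m)) \<le> (\<Sum>m<N. (\<eta>^2 * real N + C) / (\<eta> * real N))"
      proof (intro sum_mono)
        fix m assume "m \<in> {..<N}"
        have "prob (B m) \<le> expectation (\<lambda>\<omega>. \<bar>S m \<omega>\<bar>) / (\<eta> * real N)"
          unfolding B_def using \<eta> \<open>N > 0\<close> by (intro prob_abs_greater_le_expectation S_int) auto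
        also have "expectation (\<lambda>\<omega>. \<bar>S m \<omega>\<bar>) \<le> \<eta>^2 * real N + C"
          using C[of m] \<open>m \<in> {..<N}\<close> \<eta> by (smt (verit) lessThan_iff mult_left_mono of_nat_less_iff zero_less_power)
        finally show "prob (B m) \<le> (\<eta>^2 * real N + C) / (\<eta> * real N)"
          using \<eta> by (simp add: divide_right_mono)
      qed
      also have "(\<Sum>m<N. (\<eta>^2 * real N + C) / (\<eta> * real N)) = \<eta> * real N + C / \<eta>"
        using \<eta> \<open>N > 0\<close> by (simp add: field_simps power2_eq_square)
      finally have "real N * c \<le> real N * (\<eta> * (2 / \<epsilon> + 1)) + (1 + C / \<eta>)"
        by (simp add: algebra_simps)
      then show ?thesis using \<open>N > 0\<close> by (simp add: field_simps)
    qed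
    have "(\<lambda>N. \<eta> * (2 / \<epsilon> + 1) + (1 + C / \<eta>) / real N) \<longlonglongrightarrow> \<eta> * (2 / \<epsilon> + 1) + 0"
      by (intro tendsto_intros lim_const_over_n)
    then show ?thesis
      using bound by (intro LIMSEQ_le_const[where X="\<lambda>N. \<eta> * (2 / \<epsilon> + 1) + (1 + C / \<eta>) / real N"])
        (auto intro!: exI[of _ 1])
  qed
  have "c \<le> 0"
  proof (rule field_le_epsilon)
    fix e :: real assume "e > 0"
    moreover have "2 / \<epsilon> + 1 > 0" using \<open>\<epsilon> > 0\<close> by (simp add: add_pos_pos)
    ultimately show "c \<le> 0 + e" using key[of "e / (2 / \<epsilon> + 1)"] by simp
  qed
  then show ?thesis using c0 unfolding c_def by (rule antisym)
qed

text \<open>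
  Almost surely, from every time \<open>m\<close> the walk comes back within every \<open>\<epsilon>\<close> of its position at \<open>m\<close>.
  Chaining such returns with tolerances \<open>\<epsilon>/2, \<epsilon>/4, \<dots>\<close>, starting at time \<open>0\<close>, yields arbitrarily late
  visits near \<open>0\<close>.
\<close>

lemma stationary_walk_returns:
  assumes W: "stationary_sequence W" and int: "\<And>i. integrable M (W i)"
    and small: "\<And>\<delta>. \<delta> > 0 \<Longrightarrow> \<exists>C. \<forall>n. expectation (\<lambda>\<omega>. \<bar>\<Sum>i<n. W i \<omega>\<bar>) \<le> \<delta> * real n + C"
  shows "AE \<omega> in M. \<forall>\<epsilon>>0. \<forall>k. \<exists>n\<ge>k. \<bar>\<Sum>i<n. W i \<omega>\<bar> < \<epsilon>"
proof -
  note [measurable] = stationary_sequence_measurable[OF W]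
  have "AE \<omega> in M. \<not> (\<forall>n\<ge>1. inverse (real (Suc j)) \<le> \<bar>\<Sum>i<n. W (m + i) \<omega>\<bar>)" for j m
  proof (rule AE_I')
    have "prob {\<omega>\<in>space M. \<forall>n\<ge>1. inverse (real (Suc j)) \<le> \<bar>\<Sum>i<n. W (m + i) \<omega>\<bar>} = 0"
      using stationary_sequence_prob_shift[OF W pred_partial_sums_ge] no_return_prob_zero[OF W int small]
      by simp
    then show "{\<omega>\<in>space M. \<forall>n\<ge>1. inverse (real (Suc j)) \<le> \<bar>\<Sum>i<n. W (m + i) \<omega>\<bar>} \<in> null_sets M"
      by (intro null_setsI) (simp add: emeasure_eq_measure, measurable)
  qed auto
  then have "AE \<omega> in M. \<forall>j m. \<not> (\<forall>n\<ge>1. inverse (real (Suc j)) \<le> \<bar>\<Sum>i<n. W (m + i) \<omega>\<bar>)"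
    by (simp only: AE_all_countable) blast
  then show ?thesis
  proof eventually_elim
    fix \<omega> assume ret: "\<forall>j m. \<not> (\<forall>n\<ge>1. inverse (real (Suc j)) \<le> \<bar>\<Sum>i<n. W (m + i) \<omega>\<bar>)"
    have split: "(\<Sum>i<m + n. W i \<omega>) = (\<Sum>i<m. W i \<omega>) + (\<Sum>i<n. W (m + i) \<omega>)" for m n
      by (induction n) auto
    have "\<exists>n\<ge>k. \<bar>\<Sum>i<n. W i \<omega>\<bar> < \<epsilon>" if "\<epsilon> > 0" for k \<epsilon>
      using that
    proof (induction k arbitrary: \<epsilon>)
      case 0
      then show ?case by (intro exI[of _ 0]) auto
    next
      case (Suc k)
      obtain m where m: "m \<ge> k" "\<bar>\<Sum>i<m. W i \<omega>\<bar> < \<epsilon> / 2"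
        using Suc.IH[of "\<epsilon> / 2"] Suc.prems by auto
      obtain j where j: "inverse (real (Suc j)) < \<epsilon> / 2"
        using reals_Archimedean[of "\<epsilon> / 2"] Suc.prems by auto
      obtain n where "n \<ge> 1" "\<bar>\<Sum>i<n. W (m + i) \<omega>\<bar> < inverse (real (Suc j))"
        using ret by (meson not_le)
      then show ?case using m j split[of m n]
        by (intro exI[of _ "m + n"]) auto
    qed
    then show "\<forall>\<epsilon>>0. \<forall>k. \<exists>n\<ge>k. \<bar>\<Sum>i<n. W i \<omega>\<bar> < \<epsilon>" by blast
  qed
qed

section \<open>Mean zero: sublinear growth in mean\<close>

lemma expectation_square_sum_le:
  fixes U :: "nat \<Rightarrow> 'a \<Rightarrow> real"
  assumes ind: "indep_vars (\<lambda>_. borel) U UNIV"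
    and bd: "\<And>i \<omega>. \<omega> \<in> space M \<Longrightarrow> \<bar>U i \<omega>\<bar> \<le> B"
    and mean: "\<And>i. expectation (U i) = 0"
  shows "integrable M (\<lambda>\<omega>. (\<Sum>i<n. U i \<omega>)\<^sup>2) \<and> expectation (\<lambda>\<omega>. (\<Sum>i<n. U i \<omega>)\<^sup>2) \<le> real n * B\<^sup>2"
proof (induction n)
  case 0
  then show ?case by simp
next
  case (Suc n)
  have [measurable]: "random_variable borel (U i)" for i
    using ind by (auto simp: indep_vars_def2)
  have int: "integrable M (U i)" for i
    by (intro integrable_const_bound[where B=B]) (auto intro: bd)
  have sq: "(U n \<omega>)\<^sup>2 \<le> B\<^sup>2" if "\<omega> \<in> space M" for \<omega>
    using bd[OF that, of n] by (metis abs_ge_zero power2_abs power_mono)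
  have int_sq: "integrable M (\<lambda>\<omega>. (U n \<omega>)\<^sup>2)"
    by (intro integrable_const_bound[where B="B\<^sup>2"]) (auto intro: sq)
  have iv: "indep_var borel (U n) borel (\<lambda>\<omega>. \<Sum>i<n. U i \<omega>)"
    by (intro indep_vars_sum indep_vars_subset[OF ind]) auto
  have int_S: "integrable M (\<lambda>\<omega>. \<Sum>i<n. U i \<omega>)"
    by (intro Bochner_Integration.integrable_sum int)
  have cross: "integrable M (\<lambda>\<omega>. U n \<omega> * (\<Sum>i<n. U i \<omega>))"
      "expectation (\<lambda>\<omega>. U n \<omega> * (\<Sum>i<n. U i \<omega>)) = 0"
    using indep_var_integrable[OF iv int int_S] indep_var_lebesgue_integral[OF iv int int_S] mean
    by auto
  have eq: "(\<Sum>i<Suc n. U i \<omega>)\<^sup>2 = (\<Sum>i<n. U i \<omega>)\<^sup>2 + 2 * (U n \<omega> * (\<Sum>i<n. U i \<omega>)) + (U n \<omega>)\<^sup>2" for \<omega>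
    by (simp add: power2_eq_square algebra_simps)
  have "expectation (\<lambda>\<omega>. (U n \<omega>)\<^sup>2) \<le> expectation (\<lambda>_. B\<^sup>2)"
    by (intro integral_mono int_sq) (auto intro: sq)
  then have "expectation (\<lambda>\<omega>. (U n \<omega>)\<^sup>2) \<le> B\<^sup>2" by (simp add: prob_space)
  then show ?case
    unfolding eq using Suc cross int_sq by (simp add: algebra_simps)
qed

text \<open>
  This is \<open>E|S\<^sub>n| = o(n)\<close>.  Each \<open>W i\<close> splits into a bounded centred part and a tail part of small
  absolute mean.  The tail parts contribute at most a small multiple of \<open>n\<close> in mean; the bounded parts
  are orthogonal, so their sum has second moment \<open>O(n)\<close>.
\<close>

lemma iid_mean_zero_expectation_abs_sum:
  assumes ind: "indep_vars (\<lambda>_. borel) W UNIV"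
    and id: "\<And>i. distr M borel (W i) = distr M borel (W 0)"
    and int: "integrable M (W 0)" and mean: "expectation (W 0) = 0"
    and "\<delta> > 0"
  shows "\<exists>C. \<forall>n. expectation (\<lambda>\<omega>. \<bar>\<Sum>i<n. W i \<omega>\<bar>) \<le> \<delta> * real n + C"
proof -
  have W: "stationary_sequence W" by (rule iid_imp_stationary_sequence[OF ind id])
  note [measurable] = stationary_sequence_measurable[OF W]
  define tail where "tail K x = (if \<bar>x\<bar> > K then x else 0)" for K x :: real
  have [measurable]: "tail K \<in> borel_measurable borel" for K unfolding tail_def by measurable
  have "(\<lambda>k. expectation (\<lambda>\<omega>. \<bar>tail (real k) (W 0 \<omega>)\<bar>)) \<longlonglongrightarrow> expectation (\<lambda>_. 0)"
  proof (rule integral_dominated_convergence[where w="\<lambda>\<omega>. \<bar>W 0 \<omega>\<bar>"])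
    show "AE \<omega> in M. (\<lambda>k. \<bar>tail (real k) (W 0 \<omega>)\<bar>) \<longlonglongrightarrow> 0"
    proof (rule AE_I2)
      fix \<omega>
      have "eventually (\<lambda>k. \<bar>tail (real k) (W 0 \<omega>)\<bar> = 0) sequentially"
        using eventually_ge_at_top[of "nat \<lceil>\<bar>W 0 \<omega>\<bar>\<rceil>"]
        by eventually_elim (auto simp: tail_def nat_le_iff ceiling_le_iff)
      then show "(\<lambda>k. \<bar>tail (real k) (W 0 \<omega>)\<bar>) \<longlonglongrightarrow> 0" by (rule tendsto_eventually)
    qed
  qed (use int in \<open>auto simp: tail_def\<close>)
  then have "eventually (\<lambda>k. expectation (\<lambda>\<omega>. \<bar>tail (real k) (W 0 \<omega>)\<bar>) < \<delta> / 4) sequentially"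
    using \<open>\<delta> > 0\<close> by (auto dest: order_tendstoD(2)[of _ _ _ "\<delta> / 4"])
  then obtain k :: nat where k: "k \<ge> 1" "expectation (\<lambda>\<omega>. \<bar>tail (real k) (W 0 \<omega>)\<bar>) < \<delta> / 4"
    using eventually_conj[OF eventually_ge_at_top[of 1]] by (metis (mono_tags, lifting) eventually_sequentially order_refl)
  define K where "K = real k"
  have "K > 0" using k by (simp add: K_def)
  have int_W: "integrable M (W i)" for i
    using stationary_sequence_marginal(1)[OF W, of "\<lambda>x. x" i] int by simp
  have int_tail: "integrable M (\<lambda>\<omega>. tail K (W i \<omega>))" for i
    by (rule Bochner_Integration.integrable_bound[OF int_W[of i]]) (auto simp: tail_def)
  define c where "c = expectation (\<lambda>\<omega>. tail K (W 0 \<omega>))"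
  have tail_mean: "expectation (\<lambda>\<omega>. tail K (W i \<omega>)) = c" for i
    unfolding c_def by (rule stationary_sequence_marginal(2)[OF W]) measurable
  have tail_abs: "expectation (\<lambda>\<omega>. \<bar>tail K (W i \<omega>)\<bar>) < \<delta> / 4" for i
    using k stationary_sequence_marginal(2)[OF W, of "\<lambda>x. \<bar>tail K x\<bar>" i] by (simp add: K_def)
  have c_le: "\<bar>c\<bar> \<le> \<delta> / 4"
    using integral_abs_bound[of M "\<lambda>\<omega>. tail K (W 0 \<omega>)"] tail_abs[of 0] unfolding c_def by linarith
  have W_mean: "expectation (W i) = 0" for i
    using stationary_sequence_marginal(2)[OF W, of "\<lambda>x. x" i] mean by simp
  \<comment> \<open>Adding \<open>c\<close> centres the bounded part, because \<open>W i\<close> itself has mean zero.\<close>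
  define U where "U i \<omega> = W i \<omega> - tail K (W i \<omega>) + c" for i \<omega>
  have U_bd: "\<bar>U i \<omega>\<bar> \<le> K + \<delta>" for i \<omega>
    using c_le \<open>K > 0\<close> \<open>\<delta> > 0\<close> by (auto simp: U_def tail_def)
  have U_mean: "expectation (U i) = 0" for i
    unfolding U_def by (simp add: int_W int_tail W_mean tail_mean prob_space)
  have U_ind: "indep_vars (\<lambda>_. borel) U UNIV"
    unfolding U_def by (rule indep_vars_compose2[OF ind]) measurable
  define B where "B = K + \<delta>"
  have "B > 0" using \<open>K > 0\<close> \<open>\<delta> > 0\<close> by (simp add: B_def)
  \<comment> \<open>With this \<open>r\<close>, the bound \<open>2|x| \<le> x\<^sup>2/r + r\<close> turns the second moment \<open>n B\<^sup>2\<close> into \<open>\<delta> n / 2 + r / 2\<close>.\<close>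
  define r where "r = B\<^sup>2 / \<delta>"
  have "r > 0" using \<open>B > 0\<close> \<open>\<delta> > 0\<close> by (simp add: r_def)
  have main: "expectation (\<lambda>\<omega>. \<bar>\<Sum>i<n. W i \<omega>\<bar>) \<le> \<delta> * real n + r / 2" for n
  proof -
    have sq: "integrable M (\<lambda>\<omega>. (\<Sum>i<n. U i \<omega>)\<^sup>2)"
       "expectation (\<lambda>\<omega>. (\<Sum>i<n. U i \<omega>)\<^sup>2) \<le> real n * B\<^sup>2"
      using expectation_square_sum_le[OF U_ind, of B n] U_bd U_mean unfolding B_def by auto
    have pw: "\<bar>\<Sum>i<n. W i \<omega>\<bar> \<le> ((\<Sum>i<n. U i \<omega>)\<^sup>2 / r + r) / 2 + (\<Sum>i<n. \<bar>tail K (W i \<omega>)\<bar> + \<bar>c\<bar>)" for \<omega>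
    proof -
      have "(\<Sum>i<n. W i \<omega>) = (\<Sum>i<n. U i \<omega>) + (\<Sum>i<n. tail K (W i \<omega>) - c)"
        by (simp add: U_def flip: sum.distrib)
      moreover have "\<bar>\<Sum>i<n. tail K (W i \<omega>) - c\<bar> \<le> (\<Sum>i<n. \<bar>tail K (W i \<omega>)\<bar> + \<bar>c\<bar>)"
        by (rule order_trans[OF sum_abs]) (intro sum_mono, linarith)
      moreover have "2 * \<bar>x\<bar> \<le> x\<^sup>2 / r + r" for x
      proof -
        have "0 \<le> (\<bar>x\<bar> - r)\<^sup>2" by simp
        then have "2 * \<bar>x\<bar> * r \<le> x\<^sup>2 + r * r" by (simp add: power2_eq_square algebra_simps)
        then show ?thesis using \<open>r > 0\<close> by (simp add: field_simps)
      qed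
      from this[of "\<Sum>i<n. U i \<omega>"] have "\<bar>\<Sum>i<n. U i \<omega>\<bar> \<le> ((\<Sum>i<n. U i \<omega>)\<^sup>2 / r + r) / 2" by simp
      ultimately show ?thesis by linarith
    qed
    have "expectation (\<lambda>\<omega>. \<bar>\<Sum>i<n. W i \<omega>\<bar>)
        \<le> expectation (\<lambda>\<omega>. ((\<Sum>i<n. U i \<omega>)\<^sup>2 / r + r) / 2 + (\<Sum>i<n. \<bar>tail K (W i \<omega>)\<bar> + \<bar>c\<bar>))"
      by (intro integral_mono pw) (use sq int_W int_tail in auto)
    also have "\<dots> = (expectation (\<lambda>\<omega>. (\<Sum>i<n. U i \<omega>)\<^sup>2) / r + r) / 2 +
        (\<Sum>i<n. expectation (\<lambda>\<omega>. \<bar>tail K (W i \<omega>)\<bar>) + \<bar>c\<bar>)"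
      using sq int_tail by (simp add: prob_space)
    also have "\<dots> \<le> (real n * B\<^sup>2 / r + r) / 2 + (\<Sum>i<n. \<delta> / 4 + \<delta> / 4)"
      using sq(2) \<open>r > 0\<close> tail_abs c_le
      by (intro add_mono divide_right_mono sum_mono) (auto intro: less_imp_le)
    also have "\<dots> = \<delta> * real n + r / 2"
      using \<open>B > 0\<close> \<open>\<delta> > 0\<close> by (simp add: r_def field_simps)
    finally show ?thesis .
  qed
  then show ?thesis by blast
qed

end

section \<open>Nonzero mean: linear growth\<close>

text \<open>
  The maximum of \<open>- (x 0 + \<dots> + x (k - 1))\<close> over \<open>k \<le> n\<close>, by the recursion on which Garsia's argument
  rests.
\<close>

primrec running_max_neg :: "nat \<Rightarrow> (nat \<Rightarrow> real) \<Rightarrow> real" where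
  "running_max_neg 0 x = 0"
| "running_max_neg (Suc n) x = max 0 (running_max_neg n (\<lambda>i. x (Suc i)) - x 0)"

lemma running_max_neg_nonneg: "0 \<le> running_max_neg n x"
  by (cases n) auto

lemma running_max_neg_mono: "running_max_neg n x \<le> running_max_neg (Suc n) x"
proof (induction n arbitrary: x)
  case (Suc n)
  have "running_max_neg n (\<lambda>i. x (Suc i)) \<le> running_max_neg (Suc n) (\<lambda>i. x (Suc i))" by (rule Suc)
  then show ?case by (subst (1 2) running_max_neg.simps(2)) auto
qed simp

lemma running_max_neg_ge: "- (\<Sum>i<n. x i) \<le> running_max_neg n x"
proof (induction n arbitrary: x)
  case (Suc n)
  have "- (\<Sum>i<n. x (Suc i)) \<le> running_max_neg n (\<lambda>i. x (Suc i))" by (rule Suc)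
  then show ?case by (simp add: sum.lessThan_Suc_shift del: sum.lessThan_Suc)
qed simp

lemma running_max_neg_le: "running_max_neg n x \<le> (\<Sum>i<n. \<bar>x i\<bar>)"
proof (induction n arbitrary: x)
  case (Suc n)
  have "0 \<le> (\<Sum>i<n. \<bar>x (Suc i)\<bar>)" by (simp add: sum_nonneg)
  then show ?case using Suc[of "\<lambda>i. x (Suc i)"]
    by (simp add: sum.lessThan_Suc_shift del: sum.lessThan_Suc)
qed simp

lemma measurable_running_max_neg [measurable]:
  "running_max_neg n \<in> borel_measurable (PiM UNIV (\<lambda>_. borel))"
proof (induction n)
  case 0
  have "running_max_neg 0 = (\<lambda>_. 0)" by auto
  then show ?case by simp
next
  case (Suc n)
  note Suc [measurable]
  have [measurable]: "(\<lambda>x i. x (Suc i)) \<in> PiM UNIV (\<lambda>_. borel) \<rightarrow>\<^sub>M PiM UNIV (\<lambda>_. borel :: real measure)"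
    by (rule measurable_PiM_single') auto
  have "running_max_neg (Suc n) = (\<lambda>x. max 0 (running_max_neg n (\<lambda>i. x (Suc i)) - x 0))" by auto
  then show ?case by simp
qed

context prob_space begin

text \<open>
  Garsia's argument.  Let \<open>R n\<close> be the running maximum of the negated partial sums and \<open>\<theta>\<close> the shift.
  Where \<open>R (n + 1) > 0\<close>, the recursion reads \<open>W 0 = R n \<circ> \<theta> - R (n + 1)\<close>; elsewhere the right side is
  \<open>R n \<circ> \<theta> \<ge> 0\<close>.  Since \<open>R n \<circ> \<theta>\<close> and \<open>R n\<close> have the same mean and \<open>R n \<le> R (n + 1)\<close>, the mean of
  \<open>W 0\<close> over \<open>{R (n + 1) > 0}\<close> is at most \<open>0\<close>.  If almost every path had a negative partial sum, these
  events would exhaust the space and \<open>W 0\<close> would have mean at most \<open>0\<close>.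
\<close>

lemma maximal_ergodic_positive:
  assumes W: "stationary_sequence W" and int: "\<And>i. integrable M (W i)"
    and pos: "0 < expectation (W 0)"
  shows "prob {\<omega>\<in>space M. \<forall>n. 0 \<le> (\<Sum>i<n. W i \<omega>)} > 0"
proof (rule ccontr)
  note [measurable] = stationary_sequence_measurable[OF W]
  define R where "R n m \<omega> = running_max_neg n (\<lambda>i. W (m + i) \<omega>)" for n m \<omega>
  have [measurable]: "(\<lambda>\<omega> i. W (m + i) \<omega>) \<in> M \<rightarrow>\<^sub>M PiM UNIV (\<lambda>_. borel)" for m
    by (rule measurable_PiM_single') auto
  have R_m [measurable]: "random_variable borel (R n m)" for n m
    unfolding R_def by measurable
  have int_R: "integrable M (R n m)" for n m
  proof (rule Bochner_Integration.integrable_bound)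
    show "integrable M (\<lambda>\<omega>. \<Sum>i<n. \<bar>W (m + i) \<omega>\<bar>)" using int by auto
    have "norm (R n m \<omega>) \<le> norm (\<Sum>i<n. \<bar>W (m + i) \<omega>\<bar>)" for \<omega>
      unfolding R_def using running_max_neg_nonneg[of n "\<lambda>i. W (m + i) \<omega>"] running_max_neg_le[of n "\<lambda>i. W (m + i) \<omega>"]
      by simp
    then show "AE \<omega> in M. norm (R n m \<omega>) \<le> norm (\<Sum>i<n. \<bar>W (m + i) \<omega>\<bar>)" by simp
  qed measurable
  have R_shift: "expectation (R n m) = expectation (R n 0)" for n m
    unfolding R_def using stationary_sequence_expectation_shift(2)[OF W, of "running_max_neg n" m]
    by simp
  define Q where "Q n = {\<omega>\<in>space M. R n 0 \<omega> > 0}" for n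
  have [measurable]: "Q n \<in> events" for n unfolding Q_def by measurable
  have Garsia: "expectation (\<lambda>\<omega>. indicator (Q (Suc n)) \<omega> * W 0 \<omega>) \<le> 0" for n
  proof -
    have int_l: "integrable M (\<lambda>\<omega>. indicator (Q (Suc n)) \<omega> * W 0 \<omega>)"
      by (rule Bochner_Integration.integrable_bound[OF int[of 0]]) (auto simp: indicator_def)
    have "expectation (\<lambda>\<omega>. indicator (Q (Suc n)) \<omega> * W 0 \<omega>) \<le> expectation (\<lambda>\<omega>. R n 1 \<omega> - R (Suc n) 0 \<omega>)"
    proof (intro integral_mono int_l Bochner_Integration.integrable_diff int_R)
      fix \<omega> assume "\<omega> \<in> space M"
      have "R (Suc n) 0 \<omega> = max 0 (R n 1 \<omega> - W 0 \<omega>)" by (simp add: R_def)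
      moreover have "0 \<le> R n 1 \<omega>" unfolding R_def by (rule running_max_neg_nonneg)
      ultimately show "indicator (Q (Suc n)) \<omega> * W 0 \<omega> \<le> R n 1 \<omega> - R (Suc n) 0 \<omega>"
        using \<open>\<omega> \<in> space M\<close> by (auto simp: Q_def indicator_def)
    qed
    also have "\<dots> = expectation (R n 0) - expectation (R (Suc n) 0)"
      using int_R R_shift by simp
    also have "\<dots> \<le> 0"
      using integral_mono[OF int_R[of n 0] int_R[of "Suc n" 0]] running_max_neg_mono[of n]
      by (simp add: R_def del: running_max_neg.simps)
    finally show ?thesis .
  qed
  assume "\<not> ?thesis"
  then have "prob {\<omega>\<in>space M. \<forall>n. 0 \<le> (\<Sum>i<n. W i \<omega>)} = 0"
    using measure_nonneg[of M] by (meson not_less order_antisym)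
  then have neg: "AE \<omega> in M. \<not> (\<forall>n. 0 \<le> (\<Sum>i<n. W i \<omega>))"
    by (intro AE_I'[of "{\<omega>\<in>space M. \<forall>n. 0 \<le> (\<Sum>i<n. W i \<omega>)}"] null_setsI)
       (auto simp: emeasure_eq_measure)
  have "(\<lambda>n. expectation (\<lambda>\<omega>. indicator (Q (Suc n)) \<omega> * W 0 \<omega>)) \<longlonglongrightarrow> expectation (W 0)"
  proof (rule integral_dominated_convergence[where w="\<lambda>\<omega>. \<bar>W 0 \<omega>\<bar>"])
    show "AE \<omega> in M. (\<lambda>n. indicator (Q (Suc n)) \<omega> * W 0 \<omega>) \<longlonglongrightarrow> W 0 \<omega>"
      using neg AE_space
    proof eventually_elim
      fix \<omega> assume "\<not> (\<forall>n. 0 \<le> (\<Sum>i<n. W i \<omega>))" "\<omega> \<in> space M"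
      then obtain n where n: "(\<Sum>i<n. W i \<omega>) < 0" by (meson not_le)
      have "R n 0 \<omega> > 0" using running_max_neg_ge[of "\<lambda>i. W i \<omega>" n] n by (simp add: R_def)
      moreover have "R n 0 \<omega> \<le> R k 0 \<omega>" if "n \<le> k" for k
        using that unfolding R_def
        by (rule lift_Suc_mono_le[where f="\<lambda>n. running_max_neg n (\<lambda>i. W (0 + i) \<omega>)", OF running_max_neg_mono])
      ultimately have "\<omega> \<in> Q (Suc k)" if "n \<le> k" for k
        using that \<open>\<omega> \<in> space M\<close> unfolding Q_def by (auto intro: less_le_trans le_SucI)
      then have "eventually (\<lambda>k. indicator (Q (Suc k)) \<omega> * W 0 \<omega> = W 0 \<omega>) sequentially"
        unfolding eventually_sequentially by (intro exI[of _ n]) auto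
      then show "(\<lambda>n. indicator (Q (Suc n)) \<omega> * W 0 \<omega>) \<longlonglongrightarrow> W 0 \<omega>"
        by (rule tendsto_eventually)
    qed
  qed (use int[of 0] in \<open>auto simp: indicator_def\<close>)
  then have "expectation (W 0) \<le> 0"
    by (rule LIMSEQ_le_const2) (use Garsia in auto)
  with pos show False by simp
qed

text \<open>
  Multiply the increments by the sign of their mean and subtract half of its absolute value: the mean
  stays positive, so with positive probability all partial sums are nonnegative.
\<close>

lemma stationary_walk_linear_growth:
  assumes W: "stationary_sequence W" and int: "\<And>i. integrable M (W i)"
    and ne: "expectation (W 0) \<noteq> 0"
  shows "\<exists>\<delta>>0. prob {\<omega>\<in>space M. \<forall>n. \<delta> * real n \<le> \<bar>\<Sum>i<n. W i \<omega>\<bar>} > 0"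
proof -
  note [measurable] = stationary_sequence_measurable[OF W]
  define s where "s = sgn (expectation (W 0))"
  define \<delta> where "\<delta> = \<bar>expectation (W 0)\<bar> / 2"
  have s: "\<bar>s\<bar> = 1" using ne by (simp add: s_def abs_sgn_eq)
  have "\<delta> > 0" using ne by (simp add: \<delta>_def)
  define V where "V i \<omega> = s * W i \<omega> - \<delta>" for i \<omega>
  have "s * expectation (W 0) = 2 * \<delta>"
    by (simp add: s_def \<delta>_def sgn_mult_self_eq abs_sgn mult.commute)
  then have "expectation (V 0) = \<delta>"
    unfolding V_def using int by (simp add: prob_space)
  moreover have "stationary_sequence V"
    unfolding V_def by (rule stationary_sequence_compose[OF W, of "\<lambda>x. s * x - \<delta>"]) measurable
  moreover have "integrable M (V i)" for i unfolding V_def using int by simp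
  ultimately have "0 < prob {\<omega>\<in>space M. \<forall>n. 0 \<le> (\<Sum>i<n. V i \<omega>)}"
    using \<open>\<delta> > 0\<close> by (intro maximal_ergodic_positive) auto
  also have "\<dots> \<le> prob {\<omega>\<in>space M. \<forall>n. \<delta> * real n \<le> \<bar>\<Sum>i<n. W i \<omega>\<bar>}"
  proof (rule finite_measure_mono)
    have "\<delta> * real n \<le> \<bar>\<Sum>i<n. W i \<omega>\<bar>" if "0 \<le> (\<Sum>i<n. V i \<omega>)" for n \<omega>
    proof -
      have "\<delta> * real n \<le> s * (\<Sum>i<n. W i \<omega>)"
        using that by (simp add: V_def sum_subtractf sum_distrib_left mult.commute)
      also have "\<dots> \<le> \<bar>s * (\<Sum>i<n. W i \<omega>)\<bar>" by simp
      finally show ?thesis using s by (simp add: abs_mult)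
    qed
    then show "{\<omega>\<in>space M. \<forall>n. 0 \<le> (\<Sum>i<n. V i \<omega>)} \<subseteq> {\<omega>\<in>space M. \<forall>n. \<delta> * real n \<le> \<bar>\<Sum>i<n. W i \<omega>\<bar>}"
      by blast
  qed measurable
  finally show ?thesis using \<open>\<delta> > 0\<close> by blast
qed

section \<open>Sums of independent variables\<close>

text \<open>
  By Fubini's theorem \<open>U + v\<close> is integrable for almost every value \<open>v\<close> of \<open>V\<close>, hence for some \<open>v\<close>.
\<close>

lemma indep_sum_integrable_imp_integrable:
  fixes U V :: "'a \<Rightarrow> real"
  assumes ind: "indep_var borel U borel V" and int: "integrable M (\<lambda>\<omega>. U \<omega> + V \<omega>)"
  shows "integrable M U"
proof -
  note [measurable] = indep_var_rv1[OF ind] indep_var_rv2[OF ind]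
  have eq: "distr M borel U \<Otimes>\<^sub>M distr M borel V = distr M (borel \<Otimes>\<^sub>M borel) (\<lambda>\<omega>. (U \<omega>, V \<omega>))"
    using ind by (simp add: indep_var_distribution_eq)
  interpret DU: prob_space "distr M borel U" by (rule prob_space_distr) simp
  interpret DV: prob_space "distr M borel V" by (rule prob_space_distr) simp
  interpret pair_prob_space "distr M borel V" "distr M borel U" ..
  have "integrable (distr M borel U \<Otimes>\<^sub>M distr M borel V) (\<lambda>(u, v). u + v)"
    unfolding eq using int by (subst integrable_distr_eq) (auto simp: split_beta)
  then have "integrable (distr M borel V \<Otimes>\<^sub>M distr M borel U) (\<lambda>(v, u). u + v)"
    by (subst integrable_product_swap_iff[symmetric]) (simp add: split_beta add.commute)
  from AE_integrable_fst'[OF this]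
  have "AE v in distr M borel V. integrable (distr M borel U) (\<lambda>u. u + v)" by simp
  then obtain v where "integrable (distr M borel U) (\<lambda>u. u + v)"
    using eventually_happens'[OF DV.ae_filter_bot] by blast
  then have "integrable M (\<lambda>\<omega>. U \<omega> + v)" by (subst (asm) integrable_distr_eq) auto
  then have "integrable M (\<lambda>\<omega>. (U \<omega> + v) - v)" by (intro Bochner_Integration.integrable_diff) auto
  then show ?thesis by simp
qed

text \<open>
  Decompose by the first time \<open>k\<close> at which the partial sum exceeds \<open>a + b\<close> in modulus.  That event depends on the
  first \<open>k\<close> terms only, so independently of it the remaining sum is at most \<open>b\<close> with probability at
  least \<open>c\<close>, and then the whole sum exceeds \<open>a\<close>.
\<close>

lemma Ottaviani_inequality:
  fixes W :: "nat \<Rightarrow> 'a \<Rightarrow> real"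
  assumes rv [measurable]: "\<And>i. random_variable borel (W i)"
    and ind: "indep_vars (\<lambda>_. borel) W {..<n}"
    and tight: "\<And>k. k \<le> n \<Longrightarrow> c \<le> prob {\<omega>\<in>space M. \<bar>\<Sum>i\<in>{k..<n}. W i \<omega>\<bar> \<le> b}"
  shows "c * prob {\<omega>\<in>space M. \<exists>k\<le>n. a + b < \<bar>\<Sum>i<k. W i \<omega>\<bar>}
       \<le> prob {\<omega>\<in>space M. a < \<bar>\<Sum>i<n. W i \<omega>\<bar>}"
proof -
  define S where "S k \<omega> = (\<Sum>i<k. W i \<omega>)" for k \<omega>
  have S_m [measurable]: "random_variable borel (S k)" for k
    unfolding S_def by measurable
  define T where "T k = {\<omega>\<in>space M. a + b < \<bar>S k \<omega>\<bar> \<and> (\<forall>j<k. \<bar>S j \<omega>\<bar> \<le> a + b)}" for k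
  define V where "V k = {\<omega>\<in>space M. \<bar>\<Sum>i\<in>{k..<n}. W i \<omega>\<bar> \<le> b}" for k
  have [measurable]: "T k \<in> events" for k unfolding T_def by measurable
  have [measurable]: "V k \<in> events" for k unfolding V_def by measurable
  have indep: "prob (T k \<inter> V k) = prob (T k) * prob (V k)" if k: "k \<le> n" for k
  proof -
    have iv: "indep_var (PiM {..<k} (\<lambda>_. borel)) (\<lambda>\<omega>. \<lambda>i\<in>{..<k}. W i \<omega>)
        (PiM {k..<n} (\<lambda>_. borel)) (\<lambda>\<omega>. \<lambda>i\<in>{k..<n}. W i \<omega>)"
      using k by (intro indep_var_restrict[OF ind]) auto
    let ?A = "{x\<in>space (PiM {..<k} (\<lambda>_. borel :: real measure)). a + b < \<bar>\<Sum>i<k. x i\<bar> \<and> (\<forall>j<k. \<bar>\<Sum>i<j. x i\<bar> \<le> a + b)}"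
    let ?B = "{x\<in>space (PiM {k..<n} (\<lambda>_. borel :: real measure)). \<bar>\<Sum>i\<in>{k..<n}. x i\<bar> \<le> b}"
    have A: "?A \<in> sets (PiM {..<k} (\<lambda>_. borel))"
    proof -
      have partial: "(\<lambda>x. \<Sum>i<j. x i) \<in> borel_measurable (PiM {..<k} (\<lambda>_. borel :: real measure))"
        if "j \<le> k" for j
        using that by (intro borel_measurable_sum measurable_component_singleton) auto
      have "Measurable.pred (PiM {..<k} (\<lambda>_. borel)) (\<lambda>x. \<bar>\<Sum>i<j. x i\<bar> \<le> a + b)" if "j < k" for j
        using partial[of j] that by simp
      moreover have "Measurable.pred (PiM {..<k} (\<lambda>_. borel)) (\<lambda>x. a + b < \<bar>\<Sum>i<k. x i\<bar>)"
        using partial[of k] by simp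
      ultimately have "Measurable.pred (PiM {..<k} (\<lambda>_. borel))
          (\<lambda>x. a + b < \<bar>\<Sum>i<k. x i\<bar> \<and> (\<forall>j<k. \<bar>\<Sum>i<j. x i\<bar> \<le> a + b))"
        by (intro pred_intros_logic(3) pred_intros_countable(1) pred_intros_imp')
      then show ?thesis by (simp add: pred_def)
    qed
    have B: "?B \<in> sets (PiM {k..<n} (\<lambda>_. borel))" by measurable
    have T_eq: "(\<lambda>\<omega>. \<lambda>i\<in>{..<k}. W i \<omega>) -` ?A \<inter> space M = T k"
      by (auto simp: T_def S_def space_PiM)
    have V_eq: "(\<lambda>\<omega>. \<lambda>i\<in>{k..<n}. W i \<omega>) -` ?B \<inter> space M = V k"
      by (auto simp: V_def space_PiM)
    have "(\<lambda>\<omega>. (\<lambda>i\<in>{..<k}. W i \<omega>, \<lambda>i\<in>{k..<n}. W i \<omega>)) -` (?A \<times> ?B) \<inter> space M = T k \<inter> V k"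
      unfolding T_eq[symmetric] V_eq[symmetric] by auto
    with indep_varD[OF iv A B] show ?thesis unfolding T_eq V_eq by simp
  qed
  have first: "{\<omega>\<in>space M. \<exists>k\<le>n. a + b < \<bar>S k \<omega>\<bar>} = (\<Union>k\<in>{..n}. T k)"
  proof (intro equalityI subsetI)
    fix \<omega> assume "\<omega> \<in> {\<omega>\<in>space M. \<exists>k\<le>n. a + b < \<bar>S k \<omega>\<bar>}"
    then obtain k where k: "k \<le> n" "a + b < \<bar>S k \<omega>\<bar>" and w: "\<omega> \<in> space M" by auto
    define m where "m = (LEAST k. a + b < \<bar>S k \<omega>\<bar>)"
    have "a + b < \<bar>S m \<omega>\<bar>" unfolding m_def using k(2) by (rule LeastI)
    moreover have "m \<le> k" unfolding m_def using k(2) by (rule Least_le)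
    moreover have "\<bar>S j \<omega>\<bar> \<le> a + b" if "j < m" for j
      using not_less_Least[OF that[unfolded m_def]] by simp
    ultimately show "\<omega> \<in> (\<Union>k\<in>{..n}. T k)" using w k(1) by (auto simp: T_def)
  qed (auto simp: T_def)
  have disj: "disjoint_family_on T {..n}"
  proof -
    have "T k \<inter> T m = {}" if "k < m" for k m
      using that by (fastforce simp: T_def)
    then show ?thesis unfolding disjoint_family_on_def by (metis Int_commute nat_neq_iff)
  qed
  have disj': "disjoint_family_on (\<lambda>k. T k \<inter> V k) {..n}"
    using disj unfolding disjoint_family_on_def by blast
  have "c * prob (\<Union>k\<in>{..n}. T k) = (\<Sum>k\<le>n. prob (T k) * c)"
    using disj by (subst finite_measure_finite_Union) (auto simp: sum_distrib_left mult.commute)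
  also have "\<dots> \<le> (\<Sum>k\<le>n. prob (T k \<inter> V k))"
  proof (rule sum_mono)
    fix k assume "k \<in> {..n}"
    then have "c \<le> prob (V k)" using tight[of k] by (simp add: V_def)
    then show "prob (T k) * c \<le> prob (T k \<inter> V k)"
      using \<open>k \<in> {..n}\<close> by (simp add: indep mult_left_mono)
  qed
  also have "\<dots> = prob (\<Union>k\<in>{..n}. T k \<inter> V k)"
    using disj' by (subst finite_measure_finite_Union) auto
  also have "\<dots> \<le> prob {\<omega>\<in>space M. a < \<bar>S n \<omega>\<bar>}"
  proof (rule finite_measure_mono)
    show "{\<omega>\<in>space M. a < \<bar>S n \<omega>\<bar>} \<in> events" by measurable
    show "(\<Union>k\<in>{..n}. T k \<inter> V k) \<subseteq> {\<omega>\<in>space M. a < \<bar>S n \<omega>\<bar>}"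
    proof safe
      fix k \<omega> assume "k \<le> n" "\<omega> \<in> T k" "\<omega> \<in> V k"
      moreover have "S n \<omega> = S k \<omega> + (\<Sum>i\<in>{k..<n}. W i \<omega>)"
        using \<open>k \<le> n\<close> unfolding S_def
        by (metis atLeast0LessThan sum.atLeastLessThan_concat zero_le)
      ultimately show "a < \<bar>S n \<omega>\<bar>" by (auto simp: T_def V_def)
    qed (auto simp: T_def)
  qed
  finally show ?thesis using first by (simp add: S_def)
qed

section \<open>Maximal inequality for additive processes\<close>

lemma prob_abs_tail_less:
  assumes [measurable]: "random_variable borel f" and "(e::real) > 0"
  shows "\<exists>b::real. prob {\<omega>\<in>space M. b < \<bar>f \<omega>\<bar>} < e"
proof -
  define A where "A k = {\<omega>\<in>space M. real k < \<bar>f \<omega>\<bar>}" for k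
  have "(\<lambda>k. prob (A k)) \<longlonglongrightarrow> prob (\<Inter>k. A k)"
    by (rule finite_Lim_measure_decseq) (auto simp: A_def decseq_def)
  moreover have "(\<Inter>k. A k) = {}"
  proof -
    have "\<exists>k. \<omega> \<notin> A k" for \<omega>
      using reals_Archimedean2[of "\<bar>f \<omega>\<bar>"] by (auto simp: A_def not_less intro: less_imp_le)
    then show ?thesis by blast
  qed
  ultimately have "eventually (\<lambda>k. prob (A k) < e) sequentially"
    using \<open>e > 0\<close> by (auto intro: order_tendstoD)
  then obtain k where "prob (A k) < e" by (auto simp: eventually_sequentially)
  then show ?thesis unfolding A_def by blast
qed

lemma indep_vars_nat_UNIV:
  assumes "\<And>n. indep_vars N W {..<n::nat}"
  shows "indep_vars N W UNIV"
  unfolding indep_vars_def2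
proof (intro conjI ballI)
  show "random_variable (N i) (W i)" for i
    using assms[of "Suc i"] by (auto simp: indep_vars_def2)
  show "indep_sets (\<lambda>i. {W i -` A \<inter> space M |A. A \<in> sets (N i)}) UNIV"
  proof (subst indep_sets_finite_index_sets, intro allI impI)
    fix J :: "nat set" assume "finite J"
    then obtain n where "J \<subseteq> {..<n}" by (meson finite_nat_bounded)
    then show "indep_sets (\<lambda>i. {W i -` A \<inter> space M |A. A \<in> sets (N i)}) J"
      using assms[of n] by (auto simp: indep_vars_def2 intro: indep_sets_mono_index)
  qed
qed

lemma additive_process_measurable:
  "additive_process X \<Longrightarrow> 0 \<le> t \<Longrightarrow> random_variable borel (X t)"
  by (simp add: additive_process_def)

lemma additive_process_indep_increments:
  assumes "additive_process X" "0 \<le> t 0" "\<And>i. i < n \<Longrightarrow> t i < t (Suc i)"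
  shows "indep_vars (\<lambda>_. borel) (\<lambda>i \<omega>. X (t (Suc i)) \<omega> - X (t i) \<omega>) {..<n}"
  using assms by (auto simp: additive_process_def independent_increments_def)

text \<open>
  Stochastic continuity makes \<open>X\<close> vary by at most \<open>1\<close>, up to small probability, near each time.  By
  compactness finitely many times \<open>t\<close> suffice, and each single \<open>X v - X t\<close> is tight.
\<close>

lemma additive_process_increment_tight:
  assumes X: "additive_process X" and "0 \<le> u" "u \<le> v"
  shows "\<exists>b. \<forall>t\<in>{u..v}. 1 / 2 \<le> prob {\<omega>\<in>space M. \<bar>X v \<omega> - X t \<omega>\<bar> \<le> b}"
proof -
  note rv = additive_process_measurable[OF X]
  have "\<exists>U. open U \<and> t \<in> U \<and> (\<forall>s\<in>U \<inter> {0..}. prob {\<omega>\<in>space M. \<bar>X s \<omega> - X t \<omega>\<bar> > 1} < 1 / 4)"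
    if "t \<in> {u..v}" for t
  proof -
    have "0 \<le> t" using that \<open>0 \<le> u\<close> by simp
    then have "((\<lambda>s. prob {\<omega>\<in>space M. \<bar>X s \<omega> - X t \<omega>\<bar> > 1}) \<longlongrightarrow> 0) (at t within {0..})"
      using X by (auto simp: additive_process_def stochastically_continuous_def)
    then have "eventually (\<lambda>s. prob {\<omega>\<in>space M. \<bar>X s \<omega> - X t \<omega>\<bar> > 1} < 1 / 4) (at t within {0..})"
      by (rule order_tendstoD) simp
    then obtain U where "open U" "t \<in> U"
      "\<forall>s\<in>U. s \<noteq> t \<longrightarrow> s \<in> {0..} \<longrightarrow> prob {\<omega>\<in>space M. \<bar>X s \<omega> - X t \<omega>\<bar> > 1} < 1 / 4"
      unfolding eventually_at_topological by blast
    moreover have "prob {\<omega>\<in>space M. \<bar>X t \<omega> - X t \<omega>\<bar> > 1} < 1 / 4" by simp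
    ultimately show ?thesis by (intro exI[of _ U]) (metis Int_iff)
  qed
  then have "\<forall>t\<in>{u..v}. \<exists>U. open U \<and> t \<in> U \<and> (\<forall>s\<in>U \<inter> {0..}. prob {\<omega>\<in>space M. \<bar>X s \<omega> - X t \<omega>\<bar> > 1} < 1 / 4)"
    by blast
  from bchoice[OF this] obtain U where U: "\<forall>t\<in>{u..v}. open (U t) \<and> t \<in> U t \<and>
      (\<forall>s\<in>U t \<inter> {0..}. prob {\<omega>\<in>space M. \<bar>X s \<omega> - X t \<omega>\<bar> > 1} < 1 / 4)"
    by blast
  have U_op: "\<And>t. t \<in> {u..v} \<Longrightarrow> open (U t)" and U_cov: "{u..v} \<subseteq> (\<Union>t\<in>{u..v}. U t)"
    using U by blast+
  have U_near: "prob {\<omega>\<in>space M. \<bar>X s \<omega> - X t \<omega>\<bar> > 1} < 1 / 4" if "t \<in> {u..v}" "s \<in> U t" "0 \<le> s" for s t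
    using bspec[OF U that(1)] that(2,3) by blast
  obtain T where T: "T \<subseteq> {u..v}" "finite T" "{u..v} \<subseteq> (\<Union>t\<in>T. U t)"
    using compactE_image[where f=U, OF compact_Icc[of u v] U_op U_cov] by blast
  have "\<exists>b. prob {\<omega>\<in>space M. b < \<bar>X v \<omega> - X t \<omega>\<bar>} < 1 / 4" if "t \<in> T" for t
    using that T(1) \<open>0 \<le> u\<close> \<open>u \<le> v\<close>
    by (intro prob_abs_tail_less borel_measurable_diff rv) auto
  then have "\<forall>t\<in>T. \<exists>b. prob {\<omega>\<in>space M. b < \<bar>X v \<omega> - X t \<omega>\<bar>} < 1 / 4" by blast
  from bchoice[OF this] obtain B where B: "\<And>t. t \<in> T \<Longrightarrow> prob {\<omega>\<in>space M. B t < \<bar>X v \<omega> - X t \<omega>\<bar>} < 1 / 4"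
    by auto
  obtain b where b: "\<And>t. t \<in> T \<Longrightarrow> B t \<le> b"
    using finite_imageI[OF \<open>finite T\<close>, of B, THEN bdd_above_finite] by (auto simp: bdd_above_def)
  have "1 / 2 \<le> prob {\<omega>\<in>space M. \<bar>X v \<omega> - X s \<omega>\<bar> \<le> b + 1}" if s: "s \<in> {u..v}" for s
  proof -
    obtain t where t: "t \<in> T" "s \<in> U t" using T(3) s by blast
    have ge0: "0 \<le> s" "0 \<le> t" "0 \<le> v" using s t T(1) \<open>0 \<le> u\<close> by auto
    note [measurable] = rv[OF ge0(1)] rv[OF ge0(2)] rv[OF ge0(3)]
    have "1 - prob {\<omega>\<in>space M. \<bar>X v \<omega> - X s \<omega>\<bar> \<le> b + 1} = prob {\<omega>\<in>space M. \<not> \<bar>X v \<omega> - X s \<omega>\<bar> \<le> b + 1}"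
      by (subst prob_neg) auto
    also have "\<dots> \<le> prob ({\<omega>\<in>space M. B t < \<bar>X v \<omega> - X t \<omega>\<bar>} \<union> {\<omega>\<in>space M. \<bar>X s \<omega> - X t \<omega>\<bar> > 1})"
      using b[OF t(1)] by (intro finite_measure_mono) auto
    also have "\<dots> \<le> prob {\<omega>\<in>space M. B t < \<bar>X v \<omega> - X t \<omega>\<bar>} + prob {\<omega>\<in>space M. \<bar>X s \<omega> - X t \<omega>\<bar> > 1}"
      by (intro measure_Un_le) auto
    also have "\<dots> < 1 / 4 + 1 / 4"
      using B[OF t(1)] U_near[of t s] t T(1) ge0 by (intro add_strict_mono) auto
    finally show ?thesis by simp
  qed
  then show ?thesis by blast
qed

text \<open>
  Ottaviani's inequality applies to the increments over the grid of \<open>N\<close> equal steps.  By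
  right-continuity a path that exceeds the level \<open>a + b\<close> somewhere exceeds it on a small interval to the
  right, hence on every sufficiently fine grid.  The event is covered by a measurable set \<open>G\<close>, since the
  supremum over uncountably many times need not be measurable.
\<close>

lemma additive_process_maximal_inequality:
  assumes X: "additive_process X" and u: "0 \<le> u" and uv: "u < v"
    and tight: "\<And>t. t \<in> {u..v} \<Longrightarrow> c \<le> prob {\<omega>\<in>space M. \<bar>X v \<omega> - X t \<omega>\<bar> \<le> b}"
  shows "\<exists>G\<in>events. c * prob G \<le> prob {\<omega>\<in>space M. a < \<bar>X v \<omega> - X u \<omega>\<bar>} \<and>
      (AE \<omega> in M. (\<exists>t\<in>{u..v}. a + b < \<bar>X t \<omega> - X u \<omega>\<bar>) \<longrightarrow> \<omega> \<in> G)"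
proof -
  define grid where "grid N k = u + (v - u) * real k / real N" for N k :: nat
  have grid_0: "grid N 0 = u" for N by (simp add: grid_def)
  have grid_N: "grid N N = v" if "N > 0" for N using that by (simp add: grid_def)
  have grid_ge: "u \<le> grid N k" for N k using uv by (simp add: grid_def)
  have grid_less: "grid N k < grid N (Suc k)" if "N > 0" for N k
    using uv that by (simp add: grid_def divide_strict_right_mono)
  have grid_mono: "grid N k \<le> grid N n" if "k \<le> n" for N k n
    using that uv by (simp add: grid_def divide_right_mono mult_left_mono)
  have rv [measurable]: "random_variable borel (X (grid N k))" for N k
    using grid_ge[of N k] u by (intro additive_process_measurable[OF X]) simp
  have [measurable]: "random_variable borel (X u)" "random_variable borel (X v)"
    using u uv by (auto intro: additive_process_measurable[OF X])
  define E where "E N = {\<omega>\<in>space M. \<exists>k\<le>N. a + b < \<bar>X (grid N k) \<omega> - X u \<omega>\<bar>}" for N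
  have [measurable]: "E N \<in> events" for N unfolding E_def by measurable
  define D where "D = prob {\<omega>\<in>space M. a < \<bar>X v \<omega> - X u \<omega>\<bar>}"
  have E_le: "c * prob (E N) \<le> D" if N: "N > 0" for N
  proof -
    define W where "W i \<omega> = X (grid N (Suc i)) \<omega> - X (grid N i) \<omega>" for i \<omega>
    have sum: "(\<Sum>i\<in>{k..<n}. W i \<omega>) = X (grid N n) \<omega> - X (grid N k) \<omega>" if "k \<le> n" for k n \<omega>
      unfolding W_def using that by (rule sum_Suc_diff')
    have sum0: "(\<Sum>i<n. W i \<omega>) = X (grid N n) \<omega> - X u \<omega>" for n \<omega>
      using sum[of 0 n] by (simp add: atLeast0LessThan grid_0)
    have "c * prob {\<omega>\<in>space M. \<exists>k\<le>N. a + b < \<bar>\<Sum>i<k. W i \<omega>\<bar>} \<le> prob {\<omega>\<in>space M. a < \<bar>\<Sum>i<N. W i \<omega>\<bar>}"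
    proof (rule Ottaviani_inequality)
      show "random_variable borel (W i)" for i unfolding W_def by measurable
      show "indep_vars (\<lambda>_. borel) W {..<N}"
        unfolding W_def by (rule additive_process_indep_increments[OF X]) (use u grid_less N in \<open>auto simp: grid_0\<close>)
      fix k assume "k \<le> N"
      have "grid N k \<le> grid N N"
        using \<open>k \<le> N\<close> by (rule grid_mono)
      then have "grid N k \<in> {u..v}" using grid_ge[of N k] N by (simp add: grid_N)
      from tight[OF this] show "c \<le> prob {\<omega>\<in>space M. \<bar>\<Sum>i\<in>{k..<N}. W i \<omega>\<bar> \<le> b}"
        using \<open>k \<le> N\<close> N by (simp add: sum grid_N)
    qed
    then show ?thesis using N by (simp add: sum0 grid_N E_def D_def)
  qed
  \<comment> \<open>The grids are not nested, so the limit is taken along the increasing events that the level is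
    exceeded on all grids from the \<open>m\<close>-th on.  The index is \<open>Suc j\<close> because a grid needs at least one
    step.\<close>
  define F where "F m = (\<Inter>j\<in>{m..}. E (Suc j))" for m
  have [measurable]: "F m \<in> events" for m unfolding F_def by measurable
  have "(\<lambda>m. prob (F m)) \<longlonglongrightarrow> prob (\<Union>m. F m)"
    by (rule finite_Lim_measure_incseq) (auto simp: F_def incseq_def)
  then have "(\<lambda>m. c * prob (F m)) \<longlonglongrightarrow> c * prob (\<Union>m. F m)" by (intro tendsto_intros)
  moreover have "c * prob (F m) \<le> D" for m
  proof (cases "0 \<le> c")
    case True
    have "prob (F m) \<le> prob (E (Suc m))" unfolding F_def by (intro finite_measure_mono) auto
    then show ?thesis using E_le[of "Suc m"] mult_left_mono[OF _ True] by fastforce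
  next
    case False
    then have "c * prob (F m) \<le> 0" by (simp add: mult_nonpos_nonneg)
    also have "0 \<le> D" by (simp add: D_def)
    finally show ?thesis .
  qed
  ultimately have G_le: "c * prob (\<Union>m. F m) \<le> D" by (intro LIMSEQ_le_const2) auto
  have "AE \<omega> in M. \<forall>t\<ge>0. continuous (at_right t) (\<lambda>s. X s \<omega>)"
    using X by (auto simp: additive_process_def cadlag_paths_def)
  then have "AE \<omega> in M. (\<exists>t\<in>{u..v}. a + b < \<bar>X t \<omega> - X u \<omega>\<bar>) \<longrightarrow> \<omega> \<in> (\<Union>m. F m)"
    using AE_space
  proof (eventually_elim, intro impI)
    fix \<omega> assume w: "\<omega> \<in> space M" and rc: "\<forall>t\<ge>0. continuous (at_right t) (\<lambda>s. X s \<omega>)"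
    assume "\<exists>t\<in>{u..v}. a + b < \<bar>X t \<omega> - X u \<omega>\<bar>"
    then obtain t where t: "u \<le> t" "t \<le> v" "a + b < \<bar>X t \<omega> - X u \<omega>\<bar>" by auto
    \<comment> \<open>The endpoint \<open>v\<close> belongs to every grid, while right-continuity at \<open>v\<close> says nothing about \<open>[u, v]\<close>.\<close>
    have "\<exists>m. \<forall>j\<ge>m. \<exists>k\<le>Suc j. a + b < \<bar>X (grid (Suc j) k) \<omega> - X u \<omega>\<bar>"
    proof (cases "t = v")
      case True
      then show ?thesis using t(3) grid_N by (metis order_refl zero_less_Suc)
    next
      case False
      have "((\<lambda>s. X s \<omega>) \<longlongrightarrow> X t \<omega>) (at_right t)"
        using rc t(1) u by (simp add: continuous_within)
      then have "((\<lambda>s. \<bar>X s \<omega> - X u \<omega>\<bar>) \<longlongrightarrow> \<bar>X t \<omega> - X u \<omega>\<bar>) (at_right t)"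
        by (intro tendsto_intros)
      then have "eventually (\<lambda>s. a + b < \<bar>X s \<omega> - X u \<omega>\<bar>) (at_right t)"
        using t(3) by (rule order_tendstoD)
      then obtain d' where d': "t < d'" "\<And>s. t < s \<Longrightarrow> s < d' \<Longrightarrow> a + b < \<bar>X s \<omega> - X u \<omega>\<bar>"
        by (auto simp: eventually_at_right_field)
      define d where "d = min d' v"
      have d: "t < d" "d \<le> v" "d \<le> d'" using d' False t(2) by (auto simp: d_def)
      obtain m :: nat where m: "(v - u) / (d - t) < real m" using reals_Archimedean2 by blast
      have "\<exists>k\<le>Suc j. a + b < \<bar>X (grid (Suc j) k) \<omega> - X u \<omega>\<bar>" if "j \<ge> m" for j
      proof -
        define N where "N = Suc j"
        have "real m < real N" using that by (simp add: N_def)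
        with m have "(v - u) / (d - t) < real N" by simp
        then have N: "N > 0" "(v - u) / real N < d - t"
          using d(1) by (auto simp: N_def field_simps)
        define x where "x = (t - u) * real N / (v - u)"
        have "x \<ge> 0" using t(1) uv by (simp add: x_def)
        \<comment> \<open>The first grid point after \<open>t\<close>.\<close>
        define k where "k = Suc (nat \<lfloor>x\<rfloor>)"
        have k: "x < real k" "real k \<le> x + 1" using \<open>x \<ge> 0\<close> by (simp_all add: k_def) linarith+
        have tx: "t = u + (v - u) * x / real N" using uv N(1) by (simp add: x_def)
        have "t < grid N k"
          unfolding grid_def using k(1) uv N(1) by (subst tx) (simp add: divide_strict_right_mono)
        moreover have "grid N k \<le> u + (v - u) * (x + 1) / real N"
          unfolding grid_def using k(2) uv N(1) by (simp add: divide_right_mono)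
        moreover have "u + (v - u) * (x + 1) / real N = t + (v - u) / real N"
          by (subst tx) (simp add: add_divide_distrib distrib_left)
        ultimately have tk: "t < grid N k" "grid N k < d" using N(2) by auto
        have "k \<le> N"
        proof (rule ccontr)
          assume "\<not> k \<le> N"
          then have "grid N N \<le> grid N k" by (intro grid_mono) simp
          then show False using tk(2) d(2) N(1) by (simp add: grid_N)
        qed
        then show ?thesis using d'(2)[of "grid N k"] tk d(3) unfolding N_def by auto
      qed
      then show ?thesis by blast
    qed
    then show "\<omega> \<in> (\<Union>m. F m)" using w by (auto simp: F_def E_def)
  qed
  then show ?thesis using G_le unfolding D_def by (intro bexI[of _ "\<Union>m. F m"]) auto
qed

section \<open>Semi-Levy processes\<close>

lemma semi_levy_process_additive: "semi_levy_process p X \<Longrightarrow> additive_process X"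
  and semi_levy_process_period_pos: "semi_levy_process p X \<Longrightarrow> 0 < p"
  by (simp_all add: semi_levy_process_def)

lemma semi_levy_process_measurable:
  "semi_levy_process p X \<Longrightarrow> 0 \<le> t \<Longrightarrow> random_variable borel (X t)"
  by (rule additive_process_measurable[OF semi_levy_process_additive])

lemma semi_levy_process_distr_shift:
  assumes X: "semi_levy_process p X" and "0 \<le> s" "0 \<le> t"
  shows "distr M borel (\<lambda>\<omega>. X (t + real n * p) \<omega> - X (s + real n * p) \<omega>) =
    distr M borel (\<lambda>\<omega>. X t \<omega> - X s \<omega>)"
proof (induction n)
  case (Suc n)
  have p: "0 < p" by (rule semi_levy_process_period_pos[OF X])
  have "distr M borel (\<lambda>\<omega>. X ((t + real n * p) + p) \<omega> - X ((s + real n * p) + p) \<omega>) =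
      distr M borel (\<lambda>\<omega>. X (t + real n * p) \<omega> - X (s + real n * p) \<omega>)"
    using X p assms(2,3) by (simp add: semi_levy_process_def)
  with Suc show ?case by (simp add: algebra_simps)
qed simp

lemma levy_process_imp_semi_levy_process:
  assumes X: "levy_process X" and "0 < p"
  shows "semi_levy_process p X"
proof -
  have add: "additive_process X" using X by (simp add: levy_process_def)
  have law: "distr M borel (\<lambda>\<omega>. X (s + h) \<omega> - X s \<omega>) = distr M borel (\<lambda>\<omega>. X h \<omega> - X 0 \<omega>)"
    if "0 \<le> s" "0 \<le> h" for s h
    using X that by (simp add: levy_process_def)
  have le: "distr M borel (\<lambda>\<omega>. X (t + p) \<omega> - X (s + p) \<omega>) = distr M borel (\<lambda>\<omega>. X t \<omega> - X s \<omega>)"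
    if "0 \<le> s" "s \<le> t" for s t
    using law[of "s + p" "t - s"] law[of s "t - s"] that \<open>0 < p\<close> by (simp add: algebra_simps)
  \<comment> \<open>The definition of a Levy process covers forward increments only; backward ones are their negatives.\<close>
  have ge: "distr M borel (\<lambda>\<omega>. X (t + p) \<omega> - X (s + p) \<omega>) = distr M borel (\<lambda>\<omega>. X t \<omega> - X s \<omega>)"
    if "0 \<le> t" "t \<le> s" for s t
  proof -
    note [measurable] = additive_process_measurable[OF add]
    have rv: "random_variable borel (\<lambda>\<omega>. X v \<omega> - X u \<omega>)" if "0 \<le> u" "0 \<le> v" for u v
      using that by measurable
    have neg: "distr M borel (\<lambda>\<omega>. X v \<omega> - X u \<omega>) =
        distr (distr M borel (\<lambda>\<omega>. X u \<omega> - X v \<omega>)) borel uminus" if "0 \<le> u" "0 \<le> v" for u v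
      by (subst distr_distr) (use that rv in \<open>auto simp: comp_def\<close>)
    show ?thesis
      using neg[of s t] neg[of "s + p" "t + p"] le[of t s] that \<open>0 < p\<close> by simp
  qed
  show ?thesis
    unfolding semi_levy_process_def using add \<open>0 < p\<close> le ge by (metis linear)
qed

lemma integral_eq_of_distr_eq:
  fixes f g :: "'a \<Rightarrow> real"
  assumes [measurable]: "random_variable borel f" "random_variable borel g"
    and eq: "distr M borel f = distr M borel g"
  shows "integrable M f \<longleftrightarrow> integrable M g" and "expectation f = expectation g"
proof -
  have "integrable M h \<longleftrightarrow> integrable (distr M borel h) (\<lambda>x. x)" if "random_variable borel h" for h :: "'a \<Rightarrow> real"
    using that by (subst integrable_distr_eq) auto
  then show "integrable M f \<longleftrightarrow> integrable M g" using assms by metis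
  have "expectation h = (\<integral>x. x \<partial>distr M borel h)" if "random_variable borel h" for h :: "'a \<Rightarrow> real"
    using that by (subst integral_distr) auto
  then show "expectation f = expectation g" using assms by metis
qed

lemma prob_eq_of_distr_eq:
  fixes f g :: "'a \<Rightarrow> real"
  assumes f [measurable]: "random_variable borel f" and g [measurable]: "random_variable borel g"
    and eq: "distr M borel f = distr M borel g" and P [measurable]: "Measurable.pred borel P"
  shows "prob {\<omega>\<in>space M. P (f \<omega>)} = prob {\<omega>\<in>space M. P (g \<omega>)}"
proof -
  have "prob {\<omega>\<in>space M. P (h \<omega>)} = measure (distr M borel h) {x. P x}"
    if [measurable]: "random_variable borel h" for h
  proof -
    have "{x \<in> space borel. P x} \<in> sets borel" by measurable
    then show ?thesis by (subst measure_distr) (auto intro: arg_cong[where f=prob])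
  qed
  then show ?thesis using f g eq by metis
qed

lemma additive_process_zero:
  assumes "additive_process X"
  shows "integrable M (X 0)" and "expectation (X 0) = 0" and "AE \<omega> in M. X 0 \<omega> = 0"
proof -
  show ae: "AE \<omega> in M. X 0 \<omega> = 0" using assms by (simp add: additive_process_def)
  have [measurable]: "random_variable borel (X 0)" using assms by (rule additive_process_measurable) simp
  show "integrable M (X 0)"
    using integrable_cong_AE[of "X 0" M "\<lambda>_. 0"] ae by simp
  show "expectation (X 0) = 0"
    using integral_cong_AE[of "X 0" M "\<lambda>_. 0"] ae by simp
qed

text \<open>
  Up to null sets, \<open>X (n p)\<close> is a sum of \<open>n\<close> variables with the law of \<open>X p\<close>, hence integrable, and
  for \<open>t < n p\<close> it is the sum of the independent variables \<open>X t\<close> and \<open>X (n p) - X t\<close>.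
\<close>

lemma semi_levy_process_integrable:
  assumes X: "semi_levy_process p X" and int: "integrable M (X p)" and "0 \<le> t"
  shows "integrable M (X t)"
proof (cases "t = 0")
  case True
  then show ?thesis using additive_process_zero(1)[OF semi_levy_process_additive[OF X]] by simp
next
  case False
  with \<open>0 \<le> t\<close> have t: "0 < t" by simp
  have p: "0 < p" by (rule semi_levy_process_period_pos[OF X])
  have add: "additive_process X" by (rule semi_levy_process_additive[OF X])
  note rv [measurable] = semi_levy_process_measurable[OF X]
  note int0 = additive_process_zero(1)[OF add]
  have int_np: "integrable M (X (real n * p))" for n
  proof (induction n)
    case (Suc n)
    have "integrable M (\<lambda>\<omega>. X (p + real n * p) \<omega> - X (0 + real n * p) \<omega>)"
      using integral_eq_of_distr_eq(1)[OF _ _ semi_levy_process_distr_shift[OF X, of 0 p n]]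
        rv p int int0 by simp
    then have "integrable M (\<lambda>\<omega>. (X (p + real n * p) \<omega> - X (0 + real n * p) \<omega>) + X (real n * p) \<omega>)"
      using Suc by (intro Bochner_Integration.integrable_add)
    then show ?case by (simp add: algebra_simps)
  qed (simp add: int0)
  obtain n :: nat where "t / p < real n" using reals_Archimedean2 by blast
  then have n: "t < real n * p" using p by (simp add: field_simps)
  define \<tau> where "\<tau> i = (if i = 0 then 0 else if i = 1 then t else real n * p)" for i :: nat
  have "indep_vars (\<lambda>_. borel) (\<lambda>i \<omega>. X (\<tau> (Suc i)) \<omega> - X (\<tau> i) \<omega>) {..<2}"
    by (rule additive_process_indep_increments[OF add]) (use t n in \<open>auto simp: \<tau>_def less_2_cases_iff\<close>)
  moreover have "{..<2::nat} = insert 0 {1}" by auto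
  ultimately have "indep_vars (\<lambda>_. borel) (\<lambda>i \<omega>. X (\<tau> (Suc i)) \<omega> - X (\<tau> i) \<omega>) (insert 0 {1})" by simp
  from indep_vars_sum[OF _ _ this]
  have "indep_var borel (\<lambda>\<omega>. X t \<omega> - X 0 \<omega>) borel (\<lambda>\<omega>. X (real n * p) \<omega> - X t \<omega>)"
    by (simp add: \<tau>_def)
  moreover have "integrable M (\<lambda>\<omega>. (X t \<omega> - X 0 \<omega>) + (X (real n * p) \<omega> - X t \<omega>))"
    using int_np[of n] int0 by simp
  ultimately have "integrable M (\<lambda>\<omega>. X t \<omega> - X 0 \<omega>)" by (rule indep_sum_integrable_imp_integrable)
  then have "integrable M (\<lambda>\<omega>. (X t \<omega> - X 0 \<omega>) + X 0 \<omega>)" using int0 by (rule Bochner_Integration.integrable_add)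
  then show ?thesis by simp
qed

text \<open>
  From any starting time \<open>s\<close> the process, observed once per period, is a random walk.  Its mean step does
  not depend on \<open>s\<close>, as \<open>X (s + p) - X p\<close> has the law of \<open>X s - X 0\<close>.
\<close>

lemma semi_levy_process_period_increments:
  assumes X: "semi_levy_process p X" and int: "integrable M (X p)" and s: "0 \<le> s"
  defines "W \<equiv> \<lambda>i \<omega>. X (s + real (Suc i) * p) \<omega> - X (s + real i * p) \<omega>"
  shows "indep_vars (\<lambda>_. borel) W UNIV"
    and "\<And>i. distr M borel (W i) = distr M borel (W 0)"
    and "\<And>i. integrable M (W i)"
    and "expectation (W 0) = expectation (X p)"
    and "\<And>n \<omega>. (\<Sum>i<n. W i \<omega>) = X (s + real n * p) \<omega> - X s \<omega>"
proof -
  have p: "0 < p" by (rule semi_levy_process_period_pos[OF X])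
  have add: "additive_process X" by (rule semi_levy_process_additive[OF X])
  note rv = semi_levy_process_measurable[OF X]
  note int_X = semi_levy_process_integrable[OF X int]
  show "indep_vars (\<lambda>_. borel) W UNIV"
    unfolding W_def
    by (intro indep_vars_nat_UNIV additive_process_indep_increments[OF add, where t="\<lambda>i. s + real i * p"])
       (use s p in auto)
  show "distr M borel (W i) = distr M borel (W 0)" for i
    using semi_levy_process_distr_shift[OF X, of s "s + p" i] s p
    by (simp add: W_def algebra_simps)
  show "integrable M (W i)" for i
    unfolding W_def using s p by (intro Bochner_Integration.integrable_diff int_X) auto
  have "expectation (\<lambda>\<omega>. X (s + p) \<omega> - X (0 + p) \<omega>) = expectation (\<lambda>\<omega>. X s \<omega> - X 0 \<omega>)"
    using X s p by (intro integral_eq_of_distr_eq(2) borel_measurable_diff rv) (auto simp: semi_levy_process_def)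
  then show "expectation (W 0) = expectation (X p)"
    using int_X[of "s + p"] int_X[of p] int_X[of s] int_X[of 0] s p additive_process_zero(2)[OF add]
    by (simp add: W_def)
  show "(\<Sum>i<n. W i \<omega>) = X (s + real n * p) \<omega> - X s \<omega>" for n \<omega>
    unfolding W_def using sum_lessThan_telescope[of "\<lambda>i. X (s + real i * p) \<omega>" n] by simp
qed

lemma semi_levy_process_mean_zero_recurrent:
  assumes X: "semi_levy_process p X" and int: "integrable M (X p)" and mean: "expectation (X p) = 0"
  shows "recurrent X"
  unfolding recurrent_def
proof (intro allI impI)
  fix s :: real assume s: "0 \<le> s"
  have p: "0 < p" by (rule semi_levy_process_period_pos[OF X])
  note W = semi_levy_process_period_increments[OF X int s]
  have "AE \<omega> in M. \<forall>\<epsilon>>0. \<forall>k. \<exists>n\<ge>k.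
      \<bar>\<Sum>i<n. X (s + real (Suc i) * p) \<omega> - X (s + real i * p) \<omega>\<bar> < \<epsilon>"
    by (rule stationary_walk_returns[OF iid_imp_stationary_sequence[OF W(1,2)] W(3)
          iid_mean_zero_expectation_abs_sum[OF W(1,2) W(3) trans[OF W(4) mean]]])
  then show "AE \<omega> in M. Liminf at_top (\<lambda>t. ereal \<bar>X t \<omega> - X s \<omega>\<bar>) = 0"
  proof eventually_elim
    fix \<omega> assume "\<forall>\<epsilon>>0. \<forall>k. \<exists>n\<ge>k.
      \<bar>\<Sum>i<n. X (s + real (Suc i) * p) \<omega> - X (s + real i * p) \<omega>\<bar> < \<epsilon>"
    then have ret: "\<exists>n\<ge>k. \<bar>X (s + real n * p) \<omega> - X s \<omega>\<bar> < \<epsilon>" if "\<epsilon> > 0" for \<epsilon> k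
      using that unfolding W(5) by blast
    let ?L = "Liminf at_top (\<lambda>t. ereal \<bar>X t \<omega> - X s \<omega>\<bar>)"
    have "\<not> 0 < ?L"
    proof
      assume "0 < ?L"
      then obtain y where y: "0 < ereal y" "ereal y < ?L" by (meson ereal_dense2)
      from less_LiminfD[OF y(2)] obtain T where T: "\<And>t. t \<ge> T \<Longrightarrow> y < \<bar>X t \<omega> - X s \<omega>\<bar>"
        by (auto simp: eventually_at_top_linorder)
      obtain k :: nat where "T / p < real k" using reals_Archimedean2 by blast
      then have k: "T < real k * p" using p by (simp add: field_simps)
      obtain n where n: "n \<ge> k" "\<bar>X (s + real n * p) \<omega> - X s \<omega>\<bar> < y" using ret[of y k] y(1) by auto
      have "real k * p \<le> real n * p" using n(1) p by simp
      then show False using T[of "s + real n * p"] n(2) k s by simp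
    qed
    moreover have "0 \<le> ?L" by (rule Liminf_bounded) simp
    ultimately show "?L = 0" by simp
  qed
qed

text \<open>
  By the maximal inequality and periodicity, the probability that the oscillation over the \<open>n\<close>-th period
  exceeds \<open>\<eta> n + b\<close> is at most twice that of \<open>|X p - X 0| > \<eta> n\<close>, with the same \<open>b\<close> for all periods.
  The latter probabilities are summable because \<open>X p\<close> is integrable, and the Borel-Cantelli lemma
  applies.
\<close>

lemma semi_levy_process_period_oscillation:
  assumes X: "semi_levy_process p X" and int: "integrable M (X p)"
  shows "\<exists>b. \<forall>\<eta>>0. AE \<omega> in M. \<forall>\<^sub>F n in sequentially.
      \<forall>t\<in>{real n * p..real (Suc n) * p}. \<bar>X t \<omega> - X (real n * p) \<omega>\<bar> \<le> \<eta> * real n + b"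
proof -
  have p: "0 < p" by (rule semi_levy_process_period_pos[OF X])
  have add: "additive_process X" by (rule semi_levy_process_additive[OF X])
  note rv = semi_levy_process_measurable[OF X]
  define D where "D \<omega> = X p \<omega> - X 0 \<omega>" for \<omega>
  have int_D: "integrable M (\<lambda>\<omega>. \<bar>D \<omega>\<bar>)"
    unfolding D_def using int additive_process_zero(1)[OF add] by auto
  have [measurable]: "random_variable borel D"
    unfolding D_def using rv p by (intro borel_measurable_diff) auto
  obtain b where b: "\<forall>t\<in>{0..p}. 1 / 2 \<le> prob {\<omega>\<in>space M. \<bar>X p \<omega> - X t \<omega>\<bar> \<le> b}"
    using additive_process_increment_tight[OF add order_refl less_imp_le[OF p]] by blast
  have main: "AE \<omega> in M. \<forall>\<^sub>F n in sequentially.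
      \<forall>t\<in>{real n * p..real (Suc n) * p}. \<bar>X t \<omega> - X (real n * p) \<omega>\<bar> \<le> \<eta> * real n + b"
    if \<eta>: "\<eta> > 0" for \<eta>
  proof -
    have step: "\<exists>G\<in>events. 1 / 2 * prob G \<le> prob {\<omega>\<in>space M. \<eta> * real n < \<bar>D \<omega>\<bar>} \<and>
        (AE \<omega> in M. (\<exists>t\<in>{real n * p..real (Suc n) * p}. \<eta> * real n + b < \<bar>X t \<omega> - X (real n * p) \<omega>\<bar>) \<longrightarrow> \<omega> \<in> G)"
      for n
    proof -
      have "prob {\<omega>\<in>space M. \<eta> * real n < \<bar>X (p + real n * p) \<omega> - X (0 + real n * p) \<omega>\<bar>} =
          prob {\<omega>\<in>space M. \<eta> * real n < \<bar>X p \<omega> - X 0 \<omega>\<bar>}"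
        using p by (intro prob_eq_of_distr_eq[OF _ _ semi_levy_process_distr_shift[OF X]] borel_measurable_diff rv) auto
      then have tail: "prob {\<omega>\<in>space M. \<eta> * real n < \<bar>X (real (Suc n) * p) \<omega> - X (real n * p) \<omega>\<bar>} =
          prob {\<omega>\<in>space M. \<eta> * real n < \<bar>D \<omega>\<bar>}" by (simp add: D_def algebra_simps)
      have near: "1 / 2 \<le> prob {\<omega>\<in>space M. \<bar>X (real (Suc n) * p) \<omega> - X t \<omega>\<bar> \<le> b}"
        if t: "t \<in> {real n * p..real (Suc n) * p}" for t
      proof -
        define r where "r = t - real n * p"
        have r: "r \<in> {0..p}" using t by (auto simp: r_def algebra_simps)
        have "prob {\<omega>\<in>space M. \<bar>X (p + real n * p) \<omega> - X (r + real n * p) \<omega>\<bar> \<le> b} =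
            prob {\<omega>\<in>space M. \<bar>X p \<omega> - X r \<omega>\<bar> \<le> b}"
          using p r by (intro prob_eq_of_distr_eq[OF _ _ semi_levy_process_distr_shift[OF X]] borel_measurable_diff rv) auto
        then show ?thesis using bspec[OF b r] by (simp add: r_def algebra_simps)
      qed
      have "0 \<le> real n * p" "real n * p < real (Suc n) * p" using p by simp_all
      from additive_process_maximal_inequality[OF add this near, where a="\<eta> * real n"] show ?thesis
        unfolding tail .
    qed
    define bad where "bad n \<omega> \<longleftrightarrow>
        (\<exists>t\<in>{real n * p..real (Suc n) * p}. \<eta> * real n + b < \<bar>X t \<omega> - X (real n * p) \<omega>\<bar>)" for n \<omega>
    have "\<forall>n. \<exists>G. G \<in> events \<and> 1 / 2 * prob G \<le> prob {\<omega>\<in>space M. \<eta> * real n < \<bar>D \<omega>\<bar>} \<and>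
        (AE \<omega> in M. bad n \<omega> \<longrightarrow> \<omega> \<in> G)"
      unfolding bad_def using step by (simp add: Bex_def)
    from choice[OF this] obtain G where G: "\<forall>n. G n \<in> events \<and>
        1 / 2 * prob (G n) \<le> prob {\<omega>\<in>space M. \<eta> * real n < \<bar>D \<omega>\<bar>} \<and>
        (AE \<omega> in M. bad n \<omega> \<longrightarrow> \<omega> \<in> G n)"
      by (rule exE)
    have [measurable]: "G n \<in> events" for n using G by blast
    have G_prob: "prob (G n) \<le> 2 * prob {\<omega>\<in>space M. \<eta> * real n < \<bar>D \<omega>\<bar>}" for n
    proof -
      have "1 / 2 * prob (G n) \<le> prob {\<omega>\<in>space M. \<eta> * real n < \<bar>D \<omega>\<bar>}" using G by blast
      then show ?thesis by simp
    qed
    have G_AE: "AE \<omega> in M. bad n \<omega> \<longrightarrow> \<omega> \<in> G n" for n using G by blast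
    have "summable (\<lambda>n. prob {\<omega>\<in>space M. \<eta> * real n < \<bar>D \<omega>\<bar>})"
    proof (rule bounded_imp_summable[where B="expectation (\<lambda>\<omega>. \<bar>D \<omega>\<bar> / \<eta> + 1)"])
      fix N
      have "(\<Sum>n\<in>{..N}. prob {\<omega>\<in>space M. \<eta> * real n < \<bar>D \<omega>\<bar>}) \<le> expectation (\<lambda>\<omega>. \<bar>D \<omega>\<bar> / \<eta> + 1)"
      proof (rule sum_prob_le_expectation_count)
        show "integrable M (\<lambda>\<omega>. \<bar>D \<omega>\<bar> / \<eta> + 1)" using int_D by simp
        fix \<omega>
        have ceil: "0 \<le> \<bar>D \<omega>\<bar> / \<eta>" using \<eta> by simp
        have "{n\<in>{..N}. \<omega> \<in> {\<omega>\<in>space M. \<eta> * real n < \<bar>D \<omega>\<bar>}} \<subseteq> {..<nat \<lceil>\<bar>D \<omega>\<bar> / \<eta>\<rceil>}"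
        proof
          fix n assume "n \<in> {n\<in>{..N}. \<omega> \<in> {\<omega>\<in>space M. \<eta> * real n < \<bar>D \<omega>\<bar>}}"
          then have "real n < \<bar>D \<omega>\<bar> / \<eta>" using \<eta> by (simp add: field_simps)
          then show "n \<in> {..<nat \<lceil>\<bar>D \<omega>\<bar> / \<eta>\<rceil>}" by (simp add: zless_nat_eq_int_zless less_ceiling_iff)
        qed
        then have "card {n\<in>{..N}. \<omega> \<in> {\<omega>\<in>space M. \<eta> * real n < \<bar>D \<omega>\<bar>}} \<le> nat \<lceil>\<bar>D \<omega>\<bar> / \<eta>\<rceil>"
          using card_mono[OF finite_lessThan] by fastforce
        then show "real (card {n\<in>{..N}. \<omega> \<in> {\<omega>\<in>space M. \<eta> * real n < \<bar>D \<omega>\<bar>}}) \<le> \<bar>D \<omega>\<bar> / \<eta> + 1"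
          using ceil by linarith
      qed auto
      then show "(\<Sum>n\<le>N. prob {\<omega>\<in>space M. \<eta> * real n < \<bar>D \<omega>\<bar>}) \<le> expectation (\<lambda>\<omega>. \<bar>D \<omega>\<bar> / \<eta> + 1)" .
    qed simp
    from summable_mult[OF this, of 2] have "summable (\<lambda>n. prob (G n))"
      by (rule summable_comparison_test'[where N=0]) (use G_prob in auto)
    then have "AE \<omega> in M. \<forall>\<^sub>F n in sequentially. \<omega> \<in> space M - G n"
      by (intro borel_cantelli_AE1) (auto simp: emeasure_eq_measure)
    moreover have "AE \<omega> in M. \<forall>n. bad n \<omega> \<longrightarrow> \<omega> \<in> G n"
      using G_AE by (simp add: AE_all_countable)
    ultimately show ?thesis
    proof eventually_elim
      case (elim \<omega>)
      show ?case
        using elim(1)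
      proof eventually_elim
        case (elim n)
        then have "\<not> bad n \<omega>" using \<open>\<forall>n. bad n \<omega> \<longrightarrow> \<omega> \<in> G n\<close> by blast
        then show ?case by (simp add: bad_def not_less)
      qed
    qed
  qed
  then show ?thesis by blast
qed

text \<open>
  With positive probability the walk satisfies \<open>|S\<^sub>n| \<ge> \<delta> n\<close> for all \<open>n\<close>, while the oscillation within
  the \<open>n\<close>-th period is eventually at most \<open>\<delta> n / 2 + b\<close>.  On that event \<open>|X t - X 0|\<close> is eventually at
  least \<open>1\<close>.
\<close>

lemma semi_levy_process_mean_nonzero_not_recurrent:
  assumes X: "semi_levy_process p X" and int: "integrable M (X p)" and mean: "expectation (X p) \<noteq> 0"
  shows "\<not> recurrent X"
proof
  assume rec: "recurrent X"
  have p: "0 < p" by (rule semi_levy_process_period_pos[OF X])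
  note rv = semi_levy_process_measurable[OF X]
  note W = semi_levy_process_period_increments[OF X int order_refl]
  have "\<exists>\<delta>>0. prob {\<omega>\<in>space M. \<forall>n. \<delta> * real n \<le>
      \<bar>\<Sum>i<n. X (0 + real (Suc i) * p) \<omega> - X (0 + real i * p) \<omega>\<bar>} > 0"
    using W mean by (intro stationary_walk_linear_growth iid_imp_stationary_sequence) auto
  then obtain \<delta> where \<delta>: "\<delta> > 0"
    and growth: "prob {\<omega>\<in>space M. \<forall>n. \<delta> * real n \<le> \<bar>X (real n * p) \<omega> - X 0 \<omega>\<bar>} > 0"
    unfolding W(5) by auto
  obtain b where osc: "\<And>\<eta>. \<eta> > 0 \<Longrightarrow> AE \<omega> in M. \<forall>\<^sub>F n in sequentially.
      \<forall>t\<in>{real n * p..real (Suc n) * p}. \<bar>X t \<omega> - X (real n * p) \<omega>\<bar> \<le> \<eta> * real n + b"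
    using semi_levy_process_period_oscillation[OF X int] by blast
  have "AE \<omega> in M. Liminf at_top (\<lambda>t. ereal \<bar>X t \<omega> - X 0 \<omega>\<bar>) = 0"
    using rec by (simp add: recurrent_def)
  moreover have "AE \<omega> in M. \<forall>\<^sub>F n in sequentially.
      \<forall>t\<in>{real n * p..real (Suc n) * p}. \<bar>X t \<omega> - X (real n * p) \<omega>\<bar> \<le> \<delta> / 2 * real n + b"
    using \<delta> by (intro osc) simp
  ultimately have "AE \<omega> in M. \<not> (\<forall>n. \<delta> * real n \<le> \<bar>X (real n * p) \<omega> - X 0 \<omega>\<bar>)"
  proof eventually_elim
    case (elim \<omega>)
    show ?case
    proof
      assume lin: "\<forall>n. \<delta> * real n \<le> \<bar>X (real n * p) \<omega> - X 0 \<omega>\<bar>"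
      obtain N where N: "\<And>n t. n \<ge> N \<Longrightarrow> real n * p \<le> t \<Longrightarrow> t \<le> real (Suc n) * p \<Longrightarrow>
          \<bar>X t \<omega> - X (real n * p) \<omega>\<bar> \<le> \<delta> / 2 * real n + b"
        using elim(2) unfolding eventually_sequentially by fastforce
      \<comment> \<open>From the period \<open>K\<close> on, \<open>\<delta> n / 2 > b + 1\<close>.\<close>
      obtain K :: nat where K: "(b + 1) / (\<delta> / 2) < real K" using reals_Archimedean2 by blast
      have "1 \<le> \<bar>X t \<omega> - X 0 \<omega>\<bar>" if t: "t \<ge> real (max N K) * p" for t
      proof -
        define n where "n = nat \<lfloor>t / p\<rfloor>"
        have t0: "0 \<le> t / p" using t p by (meson divide_nonneg_pos mult_nonneg_nonneg of_nat_0_le_iff less_imp_le order_trans)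
        have "real n \<le> t / p" "t / p \<le> real (Suc n)" using t0 by (simp_all add: n_def) linarith+
        then have nt: "real n * p \<le> t" "t \<le> real (Suc n) * p" using p by (simp_all add: field_simps)
        have "real (max N K) \<le> t / p" using t p by (simp add: field_simps)
        then have n: "max N K \<le> n" unfolding n_def by (simp add: le_nat_iff le_floor_iff of_nat_max)
        then have "(b + 1) / (\<delta> / 2) < real n" using K by linarith
        then have "b + 1 < \<delta> / 2 * real n" using \<delta> by (simp add: field_simps)
        moreover have "\<bar>X t \<omega> - X (real n * p) \<omega>\<bar> \<le> \<delta> / 2 * real n + b"
          using n nt by (intro N) auto
        moreover have "\<delta> * real n \<le> \<bar>X (real n * p) \<omega> - X 0 \<omega>\<bar>" using lin by blast
        ultimately show ?thesis by linarith
      qed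
      then have "ereal 1 \<le> Liminf at_top (\<lambda>t. ereal \<bar>X t \<omega> - X 0 \<omega>\<bar>)"
        by (intro Liminf_bounded) (auto simp: eventually_at_top_linorder)
      then show False using elim(1) by simp
    qed
  qed
  then have "prob {\<omega>\<in>space M. \<forall>n. \<delta> * real n \<le> \<bar>X (real n * p) \<omega> - X 0 \<omega>\<bar>} = 0"
  proof (subst prob_eq_0)
    have "random_variable borel (X (real n * p))" "random_variable borel (X 0)" for n :: nat
      using p by (auto intro: rv)
    note this [measurable]
    show "{\<omega>\<in>space M. \<forall>n. \<delta> * real n \<le> \<bar>X (real n * p) \<omega> - X 0 \<omega>\<bar>} \<in> events" by measurable
  qed auto
  with growth show False by simp
qed

end

section \<open>The two-regime process\<close>

theorem proposition4p2:
  fixes M :: "'a measure"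
    and X Y Z :: "real \<Rightarrow> 'a \<Rightarrow> real"
    and p q :: real
  assumes "prob_space M"
    and "prob_space.levy_process M Y"
    and "prob_space.levy_process M Z"
    and "prob_space.independent_processes M Y Z"
    and "0 < q" and "q < p"
    and "prob_space.semi_levy_process M p X"
    and "AE \<omega> in M. X 0 \<omega> = 0"
    and "\<And>(n::nat) t \<omega>. \<omega> \<in> space M \<Longrightarrow> real n * p < t \<Longrightarrow> t \<le> real n * p + q \<Longrightarrow>
           X t \<omega> = X (real n * p) \<omega> + Y t \<omega> - Y (real n * p) \<omega>"
    and "\<And>(n::nat) t \<omega>. \<omega> \<in> space M \<Longrightarrow> real n * p + q < t \<Longrightarrow> t \<le> real (n + 1) * p \<Longrightarrow>
           X t \<omega> = X (real n * p + q) \<omega> + Z t \<omega> - Z (real n * p + q) \<omega>"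
    and "integrable M (\<lambda>\<omega>. \<bar>Y 1 \<omega>\<bar>)"
    and "integrable M (\<lambda>\<omega>. \<bar>Z 1 \<omega>\<bar>)"
  shows "prob_space.recurrent M X \<longleftrightarrow>
         prob_space.expectation M (\<lambda>\<omega>. Y q \<omega> + Z (p - q) \<omega>) = 0"
proof -
  interpret prob_space M by fact
  note q = \<open>0 < q\<close> \<open>q < p\<close>
  have levy_integrable: "integrable M (V t)"
    if "levy_process V" "integrable M (\<lambda>\<omega>. \<bar>V 1 \<omega>\<bar>)" "0 \<le> t" for V t
  proof -
    have V: "semi_levy_process 1 V" using that(1) by (rule levy_process_imp_semi_levy_process) simp
    have "integrable M (V 1)"
      using that(2) semi_levy_process_measurable[OF V, of 1] by (simp add: integrable_abs_iff)
    then show ?thesis using that(3) by (rule semi_levy_process_integrable[OF V])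
  qed
  note int_Y = levy_integrable[OF assms(2,11)] and int_Z = levy_integrable[OF assms(3,12)]
  have add: "additive_process X" "additive_process Y" "additive_process Z"
    using assms(2,3,7) by (auto simp: levy_process_def semi_levy_process_def)
  note zero_X = additive_process_zero[OF add(1)] and zero_Y = additive_process_zero[OF add(2)]
    and zero_Z = additive_process_zero[OF add(3)]
  have X_p: "X p \<omega> = X 0 \<omega> + (Y q \<omega> - Y 0 \<omega>) + (Z p \<omega> - Z q \<omega>)" if "\<omega> \<in> space M" for \<omega>
    using assms(9)[OF that, of 0 q] assms(10)[OF that, of 0 p] q by simp
  have int_rhs: "integrable M (\<lambda>\<omega>. X 0 \<omega> + (Y q \<omega> - Y 0 \<omega>) + (Z p \<omega> - Z q \<omega>))"
    using zero_X(1) int_Y int_Z q by auto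
  then have int_p: "integrable M (X p)"
    by (subst Bochner_Integration.integrable_cong[OF refl X_p])
  have "\<forall>s\<ge>0. \<forall>h\<ge>0. distr M borel (\<lambda>\<omega>. Z (s + h) \<omega> - Z s \<omega>) = distr M borel (\<lambda>\<omega>. Z h \<omega> - Z 0 \<omega>)"
    using assms(3) by (simp add: levy_process_def)
  from this[rule_format, of q "p - q"]
  have "distr M borel (\<lambda>\<omega>. Z p \<omega> - Z q \<omega>) = distr M borel (\<lambda>\<omega>. Z (p - q) \<omega> - Z 0 \<omega>)"
    using q by simp
  then have Z_law: "expectation (\<lambda>\<omega>. Z p \<omega> - Z q \<omega>) = expectation (\<lambda>\<omega>. Z (p - q) \<omega> - Z 0 \<omega>)"
    using q by (intro integral_eq_of_distr_eq(2) borel_measurable_diff additive_process_measurable[OF add(3)]) auto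
  have "expectation (X p) = expectation (\<lambda>\<omega>. X 0 \<omega> + (Y q \<omega> - Y 0 \<omega>) + (Z p \<omega> - Z q \<omega>))"
    by (rule Bochner_Integration.integral_cong[OF refl X_p])
  also have "\<dots> = expectation (Y q) + expectation (\<lambda>\<omega>. Z p \<omega> - Z q \<omega>)"
    using zero_X zero_Y int_Y int_Z q by simp
  also have "\<dots> = expectation (Y q) + expectation (Z (p - q))"
    unfolding Z_law using zero_Z int_Z q by simp
  also have "\<dots> = expectation (\<lambda>\<omega>. Y q \<omega> + Z (p - q) \<omega>)"
    using int_Y int_Z q by simp
  finally have mean: "expectation (X p) = expectation (\<lambda>\<omega>. Y q \<omega> + Z (p - q) \<omega>)" .
  show ?thesis
    using semi_levy_process_mean_zero_recurrent[OF assms(7) int_p]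
      semi_levy_process_mean_nonzero_not_recurrent[OF assms(7) int_p]
    unfolding mean by blast
qed

end
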